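(* For $\lambda\in(0,1)$ let $X=[0,1]^2$, let $S_0,S_1:X\to X$ be given by $S_0(x)=\lambda x$ and $S_1(x)=\lambda x+(1-\lambda,0)$, let $C=\{0\}\times[0,1]$, and let $F_C^\lambda$ be the unique non-empty compact set satisfying $F_C^\lambda=S_0(F_C^\lambda)\cup S_1(F_C^\lambda)\cup C$. Then for Lebesgue almost every $\lambda\in(1/2,0.668)$ the box dimension of $F_C^\lambda$ exists and \[ \dim_{\mathrm B} F_C^\lambda=\frac{\log(4\lambda)}{\log 2}. \]
   Context: For bounded $E\subseteq\mathbb{R}^n$ and $\delta>0$, $N_\delta(E)$ is the number of half-open cubes of the $\delta$-mesh aligned with the coordinate axes that intersect $E$; the upper and lower box dimensions are $\limsup_{\delta\to0}$ and $\liminf_{\delta\to0}$ of $\log N_\delta(E)/(-\log\delta)$, and the box dimension is their common value when they agree. *)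

theory Defs
  imports "HOL-Analysis.Analysis"
begin

definition mesh_cube :: "real \<Rightarrow> int \<times> int \<Rightarrow> (real \<times> real) set" where
  "mesh_cube \<delta> ij = {of_int (fst ij) * \<delta> ..< (of_int (fst ij) + 1) * \<delta>} \<times>
                     {of_int (snd ij) * \<delta> ..< (of_int (snd ij) + 1) * \<delta>}"

definition N_mesh :: "real \<Rightarrow> (real \<times> real) set \<Rightarrow> nat" where
  "N_mesh \<delta> E = card {ij. mesh_cube \<delta> ij \<inter> E \<noteq> {}}"

definition upper_box_dim :: "(real \<times> real) set \<Rightarrow> ereal" where
  "upper_box_dim E = Limsup (at_right 0) (\<lambda>\<delta>. ereal (ln (real (N_mesh \<delta> E)) / - ln \<delta>))"

definition lower_box_dim :: "(real \<times> real) set \<Rightarrow> ereal" where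
  "lower_box_dim E = Liminf (at_right 0) (\<lambda>\<delta>. ereal (ln (real (N_mesh \<delta> E)) / - ln \<delta>))"

definition has_box_dim :: "(real \<times> real) set \<Rightarrow> real \<Rightarrow> bool" where
  "has_box_dim E d \<longleftrightarrow> bounded E \<and> upper_box_dim E = ereal d \<and> lower_box_dim E = ereal d"

definition unit_square :: "(real \<times> real) set" where
  "unit_square = {0..1} \<times> {0..1}"

definition S0 :: "real \<Rightarrow> real \<times> real \<Rightarrow> real \<times> real" where
  "S0 lam x = lam *\<^sub>R x"

definition S1 :: "real \<Rightarrow> real \<times> real \<Rightarrow> real \<times> real" where
  "S1 lam x = lam *\<^sub>R x + (1 - lam, 0)"

definition condensation_set :: "(real \<times> real) set" where
  "condensation_set = {0} \<times> {0..1}"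

definition F_C :: "real \<Rightarrow> (real \<times> real) set" where
  "F_C lam = (THE F. F \<noteq> {} \<and> compact F \<and> F \<subseteq> unit_square \<and>
              F = S0 lam ` F \<union> S1 lam ` F \<union> condensation_set)"

end

(* Iterating the maps shows that F_C is the interval [0,1] x {0} together with a vertical tooth of
   height lam^k above each point x_w = (1 - lam) * sum_{i in w} lam^i, for w a subset of {0..k-1}.
   At scale 2^-k only the teeth of level at most k stand out, so the box count is (4 lam)^k up to
   polynomial factors as soon as the 2^k points x_w of level k meet at least 2^k / k^3 intervals of
   length 2^-k.

   For almost every lam this holds by transversality. A difference x_u - x_v is, up to the factor
   (1 - lam) * lam^m, a polynomial g with coefficients in {-1,0,1} and g(0) = 1 or -1, where m is the
   first index at which u and v differ. On [1/2, 0.668] no such g comes close to a double zero, so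
   the parameters with |g| <= r have measure O(r). Summing over pairs, the expected number of
   2^-k-close pairs is O(k 2^k); by Markov and Borel-Cantelli it is eventually at most k^3 2^k almost
   surely, and Cauchy-Schwarz gives the count of intervals.

   Transversality is a finite computation. If g = sum a_k x^k then s g(x) - x g'(x) is
   sum a_k (s - k) x^k, and for suitable integers s it is bounded away from 0 once an initial block of
   coefficients and a small range for x are fixed. A certificate tree branches on the next
   coefficient or on x and records s at its leaves. *)

theory Submission
  imports Defs "HOL-Real_Asymp.Real_Asymp"
begin

subsection \<open>Transversality\<close>

text \<open>In the computations below \<open>x\<close> ranges over an interval \<open>[p / 8000, q / 8000]\<close>, values are
  scaled by 10000, and a block of initial coefficients is stored with the last one first, which is
  the order in which Horner's scheme consumes them.\<close>

datatype cert = Pos int | Neg int | Split int cert cert | Extend cert cert cert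

text \<open>For \<open>n = 0\<close> this is \<open>s * g x - x * g' x\<close>, where \<open>g\<close> has coefficient list \<open>as\<close>.\<close>

fun euler_form :: "int \<Rightarrow> real \<Rightarrow> int \<Rightarrow> int list \<Rightarrow> real" where
  "euler_form s x n [] = 0"
| "euler_form s x n (a # as) = of_int (a * (s - n)) + x * euler_form s x (n + 1) as"

text \<open>Horner's scheme in integer interval arithmetic, with \<open>t\<close> the sign. The
  running lower bound \<open>v\<close> is multiplied by the left end \<open>p\<close> if it is
  non-negative and by the right end \<open>q\<close> otherwise, and \<open>div\<close> rounds down,
  so every step errs on the safe side. The head of the list has index \<open>n - 1\<close>.\<close>

fun horner_lower :: "int \<Rightarrow> int \<Rightarrow> int \<Rightarrow> int \<Rightarrow> int \<Rightarrow> int list \<Rightarrow> int \<Rightarrow> int" where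
  "horner_lower p q t s n [] v = v"
| "horner_lower p q t s n (a # rs) v =
     horner_lower p q t s (n - 1) rs
       (t * a * (s - (n - 1)) * 10000 + ((if 0 \<le> v then p else q) * v) div 8000)"

text \<open>This is -10000 * (|s - n| / (1 - x) + x / (1 - x)^2) at \<open>x = q / 8000\<close> with
  denominators cleared, rounded down. It bounds whatever the unknown coefficients from index
  \<open>n\<close> on contribute.\<close>

definition tail_lower :: "int \<Rightarrow> int \<Rightarrow> int \<Rightarrow> int" where
  "tail_lower q s n =
     (- ((\<bar>s - n\<bar> * 8000 * (8000 - q) + 8000 * q) * 10000)) div ((8000 - q) * (8000 - q))"

text \<open>Here \<open>n\<close> coefficients are fixed. A leaf gives the sign of the form with its
  \<open>s\<close> on the whole current range and for every continuation, \<open>Split\<close> cuts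
  the range at \<open>m / 8000\<close>, and \<open>Extend\<close> branches on the next coefficient
  in the order 1, 0, -1. The cap 24 on \<open>s\<close> reappears in the transversality
  estimate.\<close>

fun check :: "int \<Rightarrow> int \<Rightarrow> int \<Rightarrow> int list \<Rightarrow> cert \<Rightarrow> bool" where
  "check p q n rs (Pos s) =
     (0 \<le> s \<and> s \<le> 24 \<and> 1 \<le> horner_lower p q 1 s n rs (tail_lower q s n))"
| "check p q n rs (Neg s) =
     (0 \<le> s \<and> s \<le> 24 \<and> 1 \<le> horner_lower p q (-1) s n rs (tail_lower q s n))"
| "check p q n rs (Split m c d) = (p \<le> m \<and> m \<le> q \<and> check p m n rs c \<and> check m q n rs d)"
| "check p q n rs (Extend c d e) =
     (check p q (n + 1) (1 # rs) c \<and> check p q (n + 1) (0 # rs) d \<and> check p q (n + 1) ((-1) # rs) e)"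

section \<open>Soundness of the certificate check\<close>

text \<open>The coefficient of x^k is at most |s - n| + k in absolute value, and the sum of (|s - n|
  + k) x^k over all k is the right-hand side. Hence the bound does not depend on the length of
  \<open>as\<close>.\<close>

lemma euler_form_bound:
  assumes "0 \<le> x" "x < 1" "set as \<subseteq> {-1, 0, 1}"
  shows "\<bar>euler_form s x n as\<bar> \<le> \<bar>of_int (s - n)\<bar> / (1 - x) + x / (1 - x)^2"
  using assms(3)
proof (induction as arbitrary: n)
  case Nil
  then show ?case using assms by simp
next
  case (Cons a as)
  have IH: "\<bar>euler_form s x (n + 1) as\<bar> \<le> \<bar>of_int (s - (n + 1))\<bar> / (1 - x) + x / (1 - x)^2"
    using Cons.IH[of "n + 1"] Cons.prems by (simp del: of_int_diff of_int_add)
  have tri: "\<bar>real_of_int (s - (n + 1))\<bar> \<le> \<bar>of_int (s - n)\<bar> + 1" by linarith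
  have a: "\<bar>real_of_int (a * (s - n))\<bar> \<le> \<bar>of_int (s - n)\<bar>"
    using Cons.prems by (auto simp: abs_mult)
  have "\<bar>euler_form s x n (a # as)\<bar> \<le> \<bar>real_of_int (a * (s - n))\<bar> + x * \<bar>euler_form s x (n + 1) as\<bar>"
    using assms abs_triangle_ineq[of "real_of_int (a * (s - n))" "x * euler_form s x (n + 1) as"]
    by (simp add: abs_mult)
  also have "\<dots> \<le> \<bar>of_int (s - n)\<bar> + x * ((\<bar>of_int (s - n)\<bar> + 1) / (1 - x) + x / (1 - x)^2)"
  proof (intro add_mono a mult_left_mono)
    show "\<bar>euler_form s x (n + 1) as\<bar> \<le> (\<bar>of_int (s - n)\<bar> + 1) / (1 - x) + x / (1 - x)^2"
      using IH divide_right_mono[OF tri, of "1 - x"] assms by linarith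
  qed (use assms in auto)
  also have "\<dots> = \<bar>of_int (s - n)\<bar> / (1 - x) + x / (1 - x)^2"
    using assms by (simp add: divide_simps power2_eq_square) (simp add: algebra_simps)?
  finally show ?case .
qed

lemma tail_lower_le:
  assumes x: "0 \<le> x" "x \<le> of_int q / 8000" and q: "0 \<le> q" "q < 8000"
    and as: "set as \<subseteq> {-1, 0, 1}" and t: "\<bar>t\<bar> = (1::int)"
  shows "of_int (tail_lower q s n) \<le> 10000 * (of_int t * euler_form s x n as)"
proof -
  define r where "r = real_of_int (8000 - q)"
  have r: "r > 0" using q by (simp add: r_def)
  have x1: "x < 1" using x q by (auto simp: field_simps)
  have 1: "r / 8000 \<le> 1 - x" using x by (simp add: r_def field_simps)
  have "\<bar>of_int t * euler_form s x n as\<bar> = \<bar>euler_form s x n as\<bar>"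
    using t by (simp add: abs_mult flip: of_int_abs)
  also have "\<dots> \<le> \<bar>of_int (s - n)\<bar> / (1 - x) + x / (1 - x)^2"
    using euler_form_bound[of x as] x x1 as by simp
  also have "\<dots> \<le> \<bar>of_int (s - n)\<bar> / (r / 8000) + (of_int q / 8000) / (r / 8000)^2"
    using x x1 1 r by (intro add_mono frac_le power_mono) auto
  also have "\<dots> = ((\<bar>of_int (s - n)\<bar> * 8000 * r + 8000 * of_int q)) / (r * r)"
    using r by (simp add: divide_simps power2_eq_square)
  finally have 2: "\<bar>of_int t * euler_form s x n as\<bar> \<le>
      ((\<bar>of_int (s - n)\<bar> * 8000 * r + 8000 * of_int q)) / (r * r)" .
  have "real_of_int (tail_lower q s n) \<le>
      real_of_int (- ((\<bar>s - n\<bar> * 8000 * (8000 - q) + 8000 * q) * 10000)) /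
      real_of_int ((8000 - q) * (8000 - q))"
    unfolding tail_lower_def by (rule real_of_int_div4)
  also have "\<dots> = - 10000 * (((\<bar>of_int (s - n)\<bar> * 8000 * r + 8000 * of_int q)) / (r * r))"
    by (simp add: r_def)
  also have "\<dots> \<le> 10000 * (of_int t * euler_form s x n as)"
    using 2 by linarith
  finally show ?thesis .
qed

text \<open>Each Horner step moves one coefficient from the fixed block to the head of the
  continuation, which is why \<open>v\<close> and \<open>as\<close> are generalised in the
  induction.\<close>

lemma horner_lower_le:
  assumes x: "of_int p / 8000 \<le> x" "x \<le> of_int q / 8000" "0 \<le> x"
    and v: "of_int v \<le> 10000 * (of_int t * euler_form s x (int (length rs)) as)"
  shows "of_int (horner_lower p q t s (int (length rs)) rs v) \<le>
    10000 * (of_int t * euler_form s x 0 (rev rs @ as))"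
  using v
proof (induction rs arbitrary: v as)
  case Nil
  then show ?case by simp
next
  case (Cons a rs)
  let ?n = "int (length rs)" and ?E = "euler_form s x (int (length (a # rs))) as"
  let ?c = "if 0 \<le> v then p else q"
  have "real_of_int ((?c * v) div 8000) \<le> of_int (?c * v) / of_int 8000"
    by (rule real_of_int_div4)
  also have "\<dots> \<le> x * of_int v"
    using x mult_right_mono[of "of_int p / 8000" x "of_int v"]
      mult_right_mono_neg[of x "of_int q / 8000" "of_int v"] by (auto split: if_splits)
  also have "\<dots> \<le> x * (10000 * (of_int t * ?E))"
    using x Cons.prems by (intro mult_left_mono) auto
  finally have "of_int (t * a * (s - ?n) * 10000 + (?c * v) div 8000) \<le>
      10000 * (of_int t * euler_form s x ?n (a # as))"
    by (simp add: algebra_simps)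
  from Cons.IH[OF this] show ?case by simp
qed

lemma euler_form_append_zero: "euler_form s x n (as @ [0]) = euler_form s x n as"
  by (induction as arbitrary: n) auto

text \<open>The leaf reached from \<open>x\<close> and \<open>as\<close> supplies \<open>s\<close>.
  Since a leaf covers continuations of every length, one finite check yields a bound uniform in the
  degree.\<close>

lemma check_sound:
  assumes "check p q (int (length rs)) rs c"
    and "of_int p / 8000 \<le> x" "x \<le> of_int q / 8000" "0 \<le> x" "0 \<le> q" "q < 8000" "0 \<le> p"
    and "set as \<subseteq> {-1, 0, 1}"
  shows "\<exists>s\<in>{0..24}. 1 / 10000 \<le> \<bar>euler_form s x 0 (rev rs @ as)\<bar>"
  using assms
proof (induction c arbitrary: p q rs as)
  case (Pos s)
  have "of_int (horner_lower p q 1 s (int (length rs)) rs (tail_lower q s (int (length rs)))) \<le>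
      10000 * (of_int 1 * euler_form s x 0 (rev rs @ as))"
    using Pos.prems by (intro horner_lower_le tail_lower_le) auto
  then show ?case using Pos.prems(1) by (intro bexI[of _ s]) auto
next
  case (Neg s)
  have "of_int (horner_lower p q (-1) s (int (length rs)) rs (tail_lower q s (int (length rs)))) \<le>
      10000 * (of_int (-1) * euler_form s x 0 (rev rs @ as))"
    using Neg.prems by (intro horner_lower_le tail_lower_le) auto
  then show ?case using Neg.prems(1) by (intro bexI[of _ s]) auto
next
  case (Split m c d)
  show ?case
  proof (cases "x \<le> of_int m / 8000")
    case True
    then show ?thesis using Split.prems by (intro Split.IH(1)[of p m]) auto
  next
    case False
    then show ?thesis using Split.prems by (intro Split.IH(2)[of m q]) auto
  qed
next
  case (Extend c d e)
  have "\<exists>b bs. set (b # bs) \<subseteq> {-1, 0, 1} \<and>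
      (\<forall>s. euler_form s x 0 (rev rs @ as) = euler_form s x 0 (rev (b # rs) @ bs))"
  \<comment> \<open>A polynomial that has ended is continued by a zero coefficient, which leaves the
    form unchanged.\<close>
  proof (cases as)
    case Nil
    then show ?thesis
      by (intro exI[of _ 0] exI[of _ "[]"]) (simp add: euler_form_append_zero)
  next
    case (Cons b bs)
    then show ?thesis using Extend.prems
      by (intro exI[of _ b] exI[of _ bs]) simp
  qed
  then obtain b bs where b: "b = 1 \<or> b = 0 \<or> b = -1" and bs: "set bs \<subseteq> {-1, 0, 1}"
    and eq: "\<And>s. euler_form s x 0 (rev rs @ as) = euler_form s x 0 (rev (b # rs) @ bs)"
    by auto
  have "\<exists>s\<in>{0..24}. 1 / 10000 \<le> \<bar>euler_form s x 0 (rev (b # rs) @ bs)\<bar>"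
    using b
  proof (elim disjE)
    assume "b = 1"
    then show ?thesis using Extend.prems bs by (intro Extend.IH(1)) (auto simp: add.commute)
  next
    assume "b = 0"
    then show ?thesis using Extend.prems bs by (intro Extend.IH(2)) (auto simp: add.commute)
  next
    assume "b = -1"
    then show ?thesis using Extend.prems bs by (intro Extend.IH(3)) (auto simp: add.commute)
  qed
  then show ?case by (simp only: eq)
qed

text \<open>A numerical witness. The proof relies on nothing about it except that it passes
  \<open>check\<close>.\<close>

definition certificate :: cert where
  "certificate =
    Extend (Pos 3) (Split 4672 (Pos 2) (Split 5008 (Pos 2) (Extend (Pos 3) (Pos 3) (Pos 3))))
    (Split 4672 (Pos 2) (Extend (Pos 3) (Split 5008 (Pos 3) (Split 5176 (Pos 3) (Split 5260 (Pos
    3) (Extend (Pos 4) (Pos 4) (Pos 4))))) (Split 5008 (Pos 3) (Extend (Pos 4) (Split 5176 (Pos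
    4) (Split 5260 (Pos 4) (Split 5302 (Pos 4) (Extend (Pos 5) (Pos 5) (Split 5323 (Pos 5)
    (Split 5333 (Pos 5) (Extend (Pos 6) (Pos 0) (Pos 0)))))))) (Split 5176 (Pos 4) (Extend
    (Split 5260 (Pos 5) (Extend (Split 5302 (Pos 6) (Split 5323 (Pos 6) (Split 5333 (Pos 6)
    (Extend (Pos 7) (Pos 7) (Extend (Split 5338 (Pos 8) (Split 5341 (Split 5339 (Pos 8) (Split
    5340 (Pos 8) (Pos 8))) (Extend (Pos 9) (Pos 0) (Pos 0)))) (Pos 0) (Pos 0)))))) (Extend
    (Extend (Split 5302 (Pos 8) (Extend (Split 5323 (Pos 9) (Split 5333 (Pos 9) (Pos 9))) (Split
    5323 (Pos 9) (Extend (Split 5333 (Split 5328 (Pos 9) (Pos 10)) (Extend (Split 5338 (Pos 11)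
    (Split 5341 (Split 5339 (Pos 11) (Split 5340 (Pos 11) (Extend (Pos 12) (Pos 12) (Pos 0))))
    (Extend (Pos 12) (Split 5342 (Pos 12) (Extend (Split 5343 (Pos 13) (Extend (Pos 14) (Pos 0)
    (Pos 0))) (Pos 0) (Pos 0))) (Pos 0)))) (Pos 0) (Pos 0))) (Pos 0) (Pos 0))) (Pos 0))) (Split
    5302 (Pos 0) (Extend (Extend (Extend (Split 5323 (Split 5312 (Pos 0) (Extend (Split 5317
    (Neg 23) (Neg 21)) (Pos 0) (Pos 0))) (Split 5333 (Split 5328 (Split 5325 (Split 5324 (Neg
    24) (Neg 24)) (Split 5326 (Neg 24) (Neg 24))) (Split 5330 (Neg 23) (Neg 23))) (Split 5338
    (Neg 24) (Neg 22)))) (Pos 0) (Pos 0)) (Pos 0) (Pos 0)) (Pos 0) (Pos 0))) (Pos 0)) (Pos 0)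
    (Pos 0)) (Pos 0))) (Extend (Extend (Extend (Split 5260 (Split 5218 (Pos 0) (Split 5239
    (Split 5228 (Split 5223 (Split 5220 (Neg 24) (Neg 24)) (Neg 24)) (Split 5233 (Neg 24) (Neg
    23))) (Split 5249 (Neg 24) (Neg 23)))) (Split 5302 (Split 5281 (Split 5270 (Neg 22) (Neg
    21)) (Split 5291 (Neg 20) (Neg 19))) (Split 5323 (Neg 23) (Neg 21)))) (Pos 0) (Pos 0)) (Pos
    0) (Pos 0)) (Pos 0) (Pos 0)) (Pos 0)))))))"

text \<open>The range is [4000/8000, 5344/8000] = [1/2, 0.668], and the block \<open>[1]\<close>
  fixes the constant coefficient.\<close>

lemma check_certificate: "check 4000 5344 1 [1] certificate"
  by code_simp

lemma euler_form_sum: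
  "euler_form s x n as = (\<Sum>i<length as. of_int (as ! i) * of_int (s - n - int i) * x ^ i)"
proof (induction as arbitrary: n)
  case (Cons a as)
  show ?case
    by (simp add: Cons sum.lessThan_Suc_shift sum_distrib_left algebra_simps del: sum.lessThan_Suc)
qed simp

text \<open>For \<open>s\<close> between 0 and 24 and \<open>x\<close> at most 1, |s g(x) - x g'(x)|
  \<le> 24 |g(x)| + |g'(x)|. The certificate bounds the left side below, so g and g' are never small
  together.\<close>

lemma transversality:
  fixes a :: "nat \<Rightarrow> int"
  assumes a: "\<And>i. a i \<in> {-1, 0, 1}" "a 0 = 1" and m: "m \<ge> 1" and x: "x \<in> {1/2..0.668}"
  shows "1 / 10000 \<le> 24 * \<bar>\<Sum>i<m. of_int (a i) * x ^ i\<bar>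
    + \<bar>\<Sum>i<m. of_int (a i) * (real i * x ^ (i - 1))\<bar>"
proof -
  have "int (length [1::int]) = 1" by simp
  then have "\<exists>s\<in>{0..24}. 1 / 10000 \<le> \<bar>euler_form s x 0 (rev [1] @ map a [1..<m])\<bar>"
    using x a(1) check_certificate by (intro check_sound[of 4000 5344 "[1]" certificate]) auto
  moreover have "rev [1] @ map a [1..<m] = map a [0..<m]"
    using a(2) m by (simp add: upt_conv_Cons)
  ultimately obtain s where s: "0 \<le> s" "s \<le> 24" "1 / 10000 \<le> \<bar>euler_form s x 0 (map a [0..<m])\<bar>"
    by auto
  let ?g = "\<Sum>i<m. of_int (a i) * x ^ i" and ?g' = "\<Sum>i<m. of_int (a i) * (real i * x ^ (i - 1))"
  \<comment> \<open>At \<open>i = 0\<close> the truncated exponent \<open>i - 1\<close> is harmless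
    because of the factor \<open>i\<close>.\<close>
  have "of_int (a i) * of_int (s - 0 - int i) * x ^ i =
      of_int s * (of_int (a i) * x ^ i) - x * (of_int (a i) * (real i * x ^ (i - 1)))" for i
    by (cases i) (simp_all add: algebra_simps)
  then have "euler_form s x 0 (map a [0..<m]) = of_int s * ?g - x * ?g'"
    by (simp add: euler_form_sum sum_distrib_left sum_subtractf)
  also have "\<bar>\<dots>\<bar> \<le> of_int s * \<bar>?g\<bar> + x * \<bar>?g'\<bar>"
    using s(1) x by (simp add: abs_mult abs_le_iff) (smt (verit) abs_mult abs_ge_self abs_ge_minus_self mult_left_mono mult_minus_right of_int_nonneg)
  also have "\<dots> \<le> 24 * \<bar>?g\<bar> + 1 * \<bar>?g'\<bar>"
    using s(2) x by (intro add_mono mult_right_mono) auto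
  finally show ?thesis using s(3) by simp
qed

subsection \<open>Measure of sublevel sets\<close>

text \<open>The terms are dominated by a multiple of i^2 * 0.668^i, which is summable, so
  \<open>M\<close> serves all degrees and coefficients. It controls how fast g' varies.\<close>

lemma second_derivative_bound:
  obtains M :: real where "M > 0"
    "\<And>(a :: nat \<Rightarrow> int) m x. (\<And>i. a i \<in> {-1, 0, 1}) \<Longrightarrow> x \<in> {1/2..0.668} \<Longrightarrow>
      \<bar>\<Sum>i<m. of_int (a i) * (real i * (real (i - 1) * x ^ (i - 1 - 1)))\<bar> \<le> M"
proof
  \<comment> \<open>The factor 4 absorbs 0.668^(-2), which is lost when the exponent i - 2 is raised
    to i.\<close>
  define f where "f = (\<lambda>i. 4 * (real i ^ 2 * 0.668 ^ i))"
  have "(\<lambda>i. real i ^ 2 * (167 / 250) ^ i) \<in> O(\<lambda>i. (9 / 10) ^ i)"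
    by real_asymp
  then have "summable (\<lambda>i. real i ^ 2 * (167 / 250) ^ i)"
    by (rule summable_comparison_test_bigo[rotated]) (simp add: summable_geometric)
  then have "summable (\<lambda>i. real i ^ 2 * 0.668 ^ i)"
    by simp
  then have f: "summable f" unfolding f_def by (rule summable_mult)
  have f0: "f i \<ge> 0" for i by (simp add: f_def)
  show "suminf f + 1 > 0" using suminf_nonneg[OF f f0] by linarith
  fix a :: "nat \<Rightarrow> int" and m :: nat and x :: real
  assume a: "\<And>i. a i \<in> {-1, 0, 1}" and x: "x \<in> {1/2..0.668}"
  have le: "\<bar>of_int (a i) * (real i * (real (i - 1) * x ^ (i - 1 - 1)))\<bar> \<le> f i" for i
  proof (cases "i < 2")
    case True
    then have "i = 0 \<or> i = 1" by auto
    then show ?thesis by (auto simp: f_def)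
  next
    case False
    then obtain j where j: "i = j + 2" by (metis add.commute le_Suc_ex not_less)
    have "\<bar>real_of_int (a i)\<bar> \<le> 1" using a[of i] by auto
    then have "\<bar>of_int (a i) * (real i * (real (i - 1) * x ^ (i - 1 - 1)))\<bar> \<le>
        1 * (real i * (real i * 0.668 ^ j))"
      unfolding abs_mult using x power_mono[of x "0.668" j] by (intro mult_mono) (auto simp: j)
    also have "\<dots> \<le> f i"
      by (simp add: f_def j power2_eq_square power_add)
    finally show ?thesis .
  qed
  have "\<bar>\<Sum>i<m. of_int (a i) * (real i * (real (i - 1) * x ^ (i - 1 - 1)))\<bar> \<le> (\<Sum>i<m. f i)"
    by (rule order_trans[OF sum_abs sum_mono]) (rule le)
  also have "\<dots> \<le> suminf f" using f f0 by (intro sum_le_suminf) auto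
  finally show "\<bar>\<Sum>i<m. of_int (a i) * (real i * (real (i - 1) * x ^ (i - 1 - 1)))\<bar> \<le> suminf f + 1"
    by simp
qed

text \<open>If |g| \<le> \<rho> at some x0 in \<open>J\<close>, then |g'| is at least 2d there and
  hence at least d on all of \<open>J\<close>. By the mean value theorem every other such point lies
  within 2 \<rho> / d of x0.\<close>

lemma sublevel_cell:
  fixes g g' :: "real \<Rightarrow> real"
  assumes g: "\<And>x. (g has_real_derivative g' x) (at x)"
    and d: "d > 0" and lip: "\<And>x y. x \<in> J \<Longrightarrow> y \<in> J \<Longrightarrow> \<bar>g' x - g' y\<bar> \<le> d"
    and tr: "\<And>x. x \<in> J \<Longrightarrow> \<bar>g x\<bar> \<le> \<rho> \<Longrightarrow> 2 * d \<le> \<bar>g' x\<bar>"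
    and J: "convex J" and \<rho>: "\<rho> > 0"
  shows "emeasure lborel {x \<in> J. \<bar>g x\<bar> \<le> \<rho>} \<le> ennreal (4 * \<rho> / d)"
proof (cases "{x \<in> J. \<bar>g x\<bar> \<le> \<rho>} = {}")
  case True
  show ?thesis unfolding True by simp
next
  case False
  then obtain x0 where x0: "x0 \<in> J" "\<bar>g x0\<bar> \<le> \<rho>" by auto
  have "\<bar>y - x0\<bar> \<le> 2 * \<rho> / d" if y: "y \<in> J" "\<bar>g y\<bar> \<le> \<rho>" for y
  proof -
    have "\<exists>\<xi>\<in>J. g y - g x0 = (y - x0) * g' \<xi>"
    proof -
      have *: "\<exists>\<xi>\<in>J. g v - g u = (v - u) * g' \<xi>" if uv: "u \<in> J" "v \<in> J" "u < v" for u v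
      proof -
        obtain \<xi> where \<xi>: "u < \<xi>" "\<xi> < v" "g v - g u = (v - u) * g' \<xi>"
          using MVT2[OF uv(3), of g g'] g by auto
        have "{u..v} \<subseteq> J" using closed_segment_subset[OF uv(1,2) J] uv(3)
          by (simp add: closed_segment_eq_real_ivl)
        then show ?thesis using \<xi> by (intro bexI[of _ \<xi>]) auto
      qed
      consider "x0 < y" | "y < x0" | "x0 = y" by linarith
      then show ?thesis
      proof cases
        case 2
        with *[OF y(1) x0(1)] obtain \<xi> where "\<xi> \<in> J" "g x0 - g y = (x0 - y) * g' \<xi>" by auto
        then show ?thesis by (intro bexI[of _ \<xi>]) (auto simp: algebra_simps)
      qed (use * x0 y in auto)
    qed
    then obtain \<xi> where \<xi>: "\<xi> \<in> J" "g y - g x0 = (y - x0) * g' \<xi>" by auto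
    have "d \<le> \<bar>g' \<xi>\<bar>" using lip[OF \<xi>(1) x0(1)] tr[OF x0] by linarith
    then have "\<bar>y - x0\<bar> * d \<le> \<bar>y - x0\<bar> * \<bar>g' \<xi>\<bar>" by (intro mult_left_mono) auto
    also have "\<dots> = \<bar>g y - g x0\<bar>" by (simp add: \<xi> abs_mult)
    also have "\<dots> \<le> 2 * \<rho>" using x0 y by linarith
    finally show ?thesis using d by (simp add: field_simps)
  qed
  then have "{x \<in> J. \<bar>g x\<bar> \<le> \<rho>} \<subseteq> {x0 - 2 * \<rho> / d .. x0 + 2 * \<rho> / d}"
    by (fastforce simp: abs_le_iff)
  then have "emeasure lborel {x \<in> J. \<bar>g x\<bar> \<le> \<rho>} \<le> emeasure lborel {x0 - 2 * \<rho> / d .. x0 + 2 * \<rho> / d}"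
    by (intro emeasure_mono) auto
  also have "\<dots> = ennreal (4 * \<rho> / d)"
    using d \<rho> by (subst emeasure_lborel_Icc) auto
  finally show ?thesis .
qed

text \<open>The parameter interval is cut into cells on which g' varies by at most \<open>d\<close>.
  Their number depends on \<open>M\<close> and \<open>d\<close> only, so one \<open>C\<close> serves
  all polynomials.\<close>

lemma sublevel_measure:
  obtains C :: real where "C > 0"
    "\<And>(a :: nat \<Rightarrow> int) m \<rho>. (\<And>i. a i \<in> {-1, 0, 1}) \<Longrightarrow> a 0 = 1 \<Longrightarrow> m \<ge> 1 \<Longrightarrow> \<rho> > 0 \<Longrightarrow>
      emeasure lborel {x \<in> {1/2..0.668}. \<bar>\<Sum>i<m. of_int (a i) * x ^ i\<bar> \<le> \<rho>} \<le> ennreal (C * \<rho>)"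
proof -
  obtain M :: real where M: "M > 0" and
    bnd: "\<And>(a :: nat \<Rightarrow> int) m x. (\<And>i. a i \<in> {-1, 0, 1}) \<Longrightarrow> x \<in> {1/2..0.668} \<Longrightarrow>
      \<bar>\<Sum>i<m. of_int (a i) * (real i * (real (i - 1) * x ^ (i - 1 - 1)))\<bar> \<le> M"
    by (rule second_derivative_bound) blast
  \<comment> \<open>For \<rho> \<le> 1/1000000, transversality gives |g'| \<ge> 1/10000 - 24/1000000
    wherever |g| \<le> \<rho>, and this exceeds 2d = 1/25000.\<close>
  define d :: real where "d = 1 / 50000"
  define \<eta> where "\<eta> = d / M"
  define N where "N = nat \<lceil>1 / \<eta>\<rceil>"
  \<comment> \<open>The first entry is for \<rho> > 1/1000000, where the interval has measure at
    most 1 \<le> 1000000 \<rho>. The second adds up the cells.\<close>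
  define C where "C = max 1000000 (real N * (4 / d))"
  have d: "d > 0" by (simp add: d_def)
  have \<eta>: "\<eta> > 0" using M d by (simp add: \<eta>_def)
  have N: "1 \<le> real N * \<eta>"
    using \<eta> real_nat_ceiling_ge[of "1 / \<eta>", folded N_def] by (simp add: field_simps)
  show thesis
  proof (rule that[of C])
    show "C > 0" by (simp add: C_def)
    fix a :: "nat \<Rightarrow> int" and m :: nat and \<rho> :: real
    assume a: "\<And>i. a i \<in> {-1, 0, 1}" "a 0 = 1" and m: "m \<ge> 1" and \<rho>: "\<rho> > 0"
    define g where "g = (\<lambda>x::real. \<Sum>i<m. of_int (a i) * x ^ i)"
    define g' where "g' = (\<lambda>x::real. \<Sum>i<m. of_int (a i) * (real i * x ^ (i - 1)))"
    define g'' where "g'' = (\<lambda>x::real. \<Sum>i<m. of_int (a i) * (real i * (real (i - 1) * x ^ (i - 1 - 1))))"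
    have Dg: "(g has_real_derivative g' x) (at x)" for x
      unfolding g_def g'_def by (auto intro!: derivative_eq_intros sum.cong)
    have Dg': "(g' has_real_derivative g'' x) (at x)" for x
      unfolding g''_def g'_def by (auto intro!: derivative_eq_intros sum.cong)
    have tr: "1 / 10000 \<le> 24 * \<bar>g x\<bar> + \<bar>g' x\<bar>" if "x \<in> {1/2..0.668}" for x
      unfolding g_def g'_def using a m that by (intro transversality) auto
    have g'': "\<bar>g'' x\<bar> \<le> M" if "x \<in> {1/2..0.668}" for x
      unfolding g''_def using a(1) that by (intro bnd) auto
    have lip: "\<bar>g' x - g' y\<bar> \<le> M * \<bar>x - y\<bar>" if "x \<in> {1/2..0.668}" "y \<in> {1/2..0.668}" for x y
      using field_differentiable_bound[of "{1/2..0.668}" g' g'' M x y] Dg' g'' that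
      by (auto simp: has_field_derivative_at_within dist_real_def)
    show "emeasure lborel {x \<in> {1/2..0.668}. \<bar>\<Sum>i<m. of_int (a i) * x ^ i\<bar> \<le> \<rho>} \<le> ennreal (C * \<rho>)"
      unfolding g_def[symmetric, THEN fun_cong]
    proof (cases "\<rho> \<le> 1 / 1000000")
      case False
      have "emeasure lborel {x \<in> {1/2..0.668}. \<bar>g x\<bar> \<le> \<rho>} \<le> emeasure lborel {1/2..0.668::real}"
        by (intro emeasure_mono) auto
      also have "\<dots> \<le> ennreal 1" by (simp add: ennreal_leI)
      also have "\<dots> \<le> ennreal (C * \<rho>)"
      proof (intro ennreal_leI)
        have "1 \<le> 1000000 * \<rho>" using False by simp
        also have "\<dots> \<le> C * \<rho>" using \<rho> by (intro mult_right_mono) (auto simp: C_def)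
        finally show "1 \<le> C * \<rho>" .
      qed
      finally show "emeasure lborel {x \<in> {1/2..0.668}. \<bar>g x\<bar> \<le> \<rho>} \<le> ennreal (C * \<rho>)" .
    next
      case True
      define J where "J = (\<lambda>j::nat. {1/2..0.668::real} \<inter> {1/2 + j * \<eta> .. 1/2 + (j + 1) * \<eta>})"
      define B where "B = (\<lambda>j. {x \<in> J j. \<bar>g x\<bar> \<le> \<rho>})"
      have cont: "continuous_on UNIV g"
        using Dg by (meson DERIV_isCont continuous_at_imp_continuous_on)
      have "{x \<in> {1/2..0.668}. \<bar>g x\<bar> \<le> \<rho>} \<subseteq> (\<Union>j<N. B j)"
      proof
        fix x assume x: "x \<in> {x \<in> {1/2..0.668}. \<bar>g x\<bar> \<le> \<rho>}"
        define j where "j = nat \<lfloor>(x - 1/2) / \<eta>\<rfloor>"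
        have "0 \<le> (x - 1/2) / \<eta>" using x \<eta> by simp
        then have j: "real j \<le> (x - 1/2) / \<eta>" "(x - 1/2) / \<eta> < real j + 1"
          unfolding j_def by linarith+
        have "(x - 1/2) / \<eta> < 1 / \<eta>" using x \<eta> by (intro divide_strict_right_mono) auto
        also have "\<dots> \<le> real N" using N \<eta> by (simp add: field_simps)
        finally have "j < N" using j(1) by linarith
        moreover have "x \<in> J j" using x j \<eta> by (auto simp: J_def field_simps)
        ultimately show "x \<in> (\<Union>j<N. B j)" using x by (auto simp: B_def)
      qed
      moreover have meas: "B j \<in> sets lborel" for j
      proof -
        have "closed {x. \<bar>g x\<bar> \<le> \<rho>}"
          using cont by (intro closed_Collect_le continuous_intros)
        moreover have "B j = J j \<inter> {x. \<bar>g x\<bar> \<le> \<rho>}" by (auto simp: B_def)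
        ultimately show ?thesis by (simp add: J_def closed_Int borel_closed)
      qed
      ultimately have "emeasure lborel {x \<in> {1/2..0.668}. \<bar>g x\<bar> \<le> \<rho>} \<le> emeasure lborel (\<Union>j<N. B j)"
        by (intro emeasure_mono) auto
      also have "\<dots> \<le> (\<Sum>j<N. emeasure lborel (B j))"
        using meas by (intro emeasure_subadditive_finite) auto
      also have "\<dots> \<le> (\<Sum>j<N. ennreal (4 * \<rho> / d))"
      proof (intro sum_mono)
        fix j
        show "emeasure lborel (B j) \<le> ennreal (4 * \<rho> / d)"
          unfolding B_def
        proof (rule sublevel_cell[where g' = g'])
          show "convex (J j)" unfolding J_def by (intro convex_Int convex_closed_interval)
          fix x y assume xy: "x \<in> J j" "y \<in> J j"
          have "\<bar>g' x - g' y\<bar> \<le> M * \<bar>x - y\<bar>" using xy by (intro lip) (auto simp: J_def)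
          also have "\<dots> \<le> M * \<eta>" using xy M by (intro mult_left_mono) (auto simp: J_def algebra_simps)
          also have "\<dots> = d" using M by (simp add: \<eta>_def)
          finally show "\<bar>g' x - g' y\<bar> \<le> d" .
        next
          fix x assume "x \<in> J j" "\<bar>g x\<bar> \<le> \<rho>"
          then show "2 * d \<le> \<bar>g' x\<bar>" using tr[of x] True by (auto simp: J_def d_def)
        qed (use Dg d \<rho> in auto)
      qed
      also have "\<dots> = ennreal (real N * (4 / d) * \<rho>)"
        using \<rho> d by (simp add: ennreal_of_nat_eq_real_of_nat flip: ennreal_mult)
      also have "\<dots> \<le> ennreal (C * \<rho>)"
        using \<rho> by (intro ennreal_leI mult_right_mono) (auto simp: C_def)
      finally show "emeasure lborel {x \<in> {1/2..0.668}. \<bar>g x\<bar> \<le> \<rho>} \<le> ennreal (C * \<rho>)" .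
    qed
  qed
qed

subsection \<open>Close pairs of teeth\<close>

text \<open>A composition of maps is encoded by the set \<open>w\<close> of positions, counted from
  the outermost map, at which \<open>S1\<close> stands. The value is the abscissa of the resulting
  image of the segment C.\<close>

definition column_pos :: "real \<Rightarrow> nat set \<Rightarrow> real" where
  "column_pos lam w = (1 - lam) * (\<Sum>i\<in>w. lam ^ i)"

definition close_params :: "nat \<Rightarrow> nat set \<Rightarrow> nat set \<Rightarrow> real set" where
  "close_params k u v = {lam \<in> {1/2..0.668}. \<bar>column_pos lam u - column_pos lam v\<bar> \<le> (1/2) ^ k}"

lemma close_params_commute: "close_params k u v = close_params k v u"
  by (simp add: close_params_def abs_minus_commute)

lemma column_pos_diff:
  assumes "u \<subseteq> {..<m + n}" "v \<subseteq> {..<m + n}" "\<And>i. i < m \<Longrightarrow> i \<in> u \<longleftrightarrow> i \<in> v"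
  shows "column_pos lam u - column_pos lam v =
    (1 - lam) * lam ^ m * (\<Sum>i<n. of_int (of_bool (m + i \<in> u) - of_bool (m + i \<in> v)) * lam ^ i)"
proof -
  have split: "(\<Sum>i<m + n. f i) = (\<Sum>i<m. f i) + (\<Sum>i<n. f (m + i))" for f :: "nat \<Rightarrow> real"
    by (induction n) auto
  have pos: "column_pos lam w = (1 - lam) * (\<Sum>i<m + n. of_bool (i \<in> w) * lam ^ i)"
    if "w \<subseteq> {..<m + n}" for w
  proof -
    have "(\<Sum>i\<in>w. lam ^ i) = (\<Sum>i\<in>w. of_bool (i \<in> w) * lam ^ i)" by (rule sum.cong) auto
    also have "\<dots> = (\<Sum>i<m + n. of_bool (i \<in> w) * lam ^ i)"
      using that by (intro sum.mono_neutral_left) auto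
    finally show ?thesis by (simp add: column_pos_def)
  qed
  have "(\<Sum>i<m. of_bool (i \<in> u) * lam ^ i) = (\<Sum>i<m. of_bool (i \<in> v) * lam ^ i)"
    using assms(3) by (intro sum.cong) auto
  moreover have "lam ^ m * (\<Sum>i<n. of_int (of_bool (m + i \<in> u) - of_bool (m + i \<in> v)) * lam ^ i) =
      (\<Sum>i<n. of_bool (m + i \<in> u) * lam ^ (m + i)) - (\<Sum>i<n. of_bool (m + i \<in> v) * lam ^ (m + i))"
    unfolding sum_distrib_left sum_subtractf[symmetric]
    by (intro sum.cong) (auto simp: power_add algebra_simps)
  ultimately show ?thesis
    unfolding pos[OF assms(1)] pos[OF assms(2)] split
    by (simp only: mult.assoc right_diff_distrib[symmetric] add_diff_cancel_left)
qed

text \<open>On the interval 1 - lam \<ge> 1/4 and lam^m \<ge> 2^-m, so closeness forces |g(lam)|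
  \<le> 4 * 2^m / 2^k for the polynomial g of \<open>column_pos_diff\<close>. The sublevel estimate
  then applies.\<close>

lemma close_params_measure:
  obtains C :: real where "C > 0"
    "\<And>k m u v. u \<subseteq> {..<k} \<Longrightarrow> v \<subseteq> {..<k} \<Longrightarrow> m < k \<Longrightarrow> (\<And>i. i < m \<Longrightarrow> i \<in> u \<longleftrightarrow> i \<in> v) \<Longrightarrow>
      (m \<in> u) \<noteq> (m \<in> v) \<Longrightarrow> emeasure lborel (close_params k u v) \<le> ennreal (C * (2 ^ m / 2 ^ k))"
proof -
  obtain C :: real where C: "C > 0" and
    sub: "\<And>(a :: nat \<Rightarrow> int) m \<rho>. (\<And>i. a i \<in> {-1, 0, 1}) \<Longrightarrow> a 0 = 1 \<Longrightarrow> m \<ge> 1 \<Longrightarrow> \<rho> > 0 \<Longrightarrow>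
      emeasure lborel {x \<in> {1/2..0.668}. \<bar>\<Sum>i<m. of_int (a i) * x ^ i\<bar> \<le> \<rho>} \<le> ennreal (C * \<rho>)"
    by (rule sublevel_measure) blast
  have main: "emeasure lborel (close_params k u v) \<le> ennreal (4 * C * (2 ^ m / 2 ^ k))"
    if u: "u \<subseteq> {..<k}" and v: "v \<subseteq> {..<k}" and m: "m < k"
      and eq: "\<And>i. i < m \<Longrightarrow> i \<in> u \<longleftrightarrow> i \<in> v" and mu: "m \<in> u" and mv: "m \<notin> v" for k m u v
  proof -
    define a :: "nat \<Rightarrow> int" where "a = (\<lambda>i. of_bool (m + i \<in> u) - of_bool (m + i \<in> v))"
    define \<rho> :: real where "\<rho> = 4 * (2 ^ m / 2 ^ k)"
    obtain n where n: "k = m + n" "n \<ge> 1" using m by (intro that[of "k - m"]) auto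
    have "\<bar>\<Sum>i<n. of_int (a i) * x ^ i\<bar> \<le> \<rho>"
      if x: "x \<in> {1/2..0.668}" "\<bar>column_pos x u - column_pos x v\<bar> \<le> (1/2) ^ k" for x
    proof -
      have "1/4 * (1/2) ^ m * \<bar>\<Sum>i<n. of_int (a i) * x ^ i\<bar> \<le>
          (1 - x) * x ^ m * \<bar>\<Sum>i<n. of_int (a i) * x ^ i\<bar>"
        using x by (intro mult_mono power_mono) auto
      also have "\<dots> = \<bar>column_pos x u - column_pos x v\<bar>"
        using x column_pos_diff[of u m n v x] u v eq by (simp add: n a_def abs_mult)
      also have "\<dots> \<le> (1/2) ^ k" by (rule x)
      finally show ?thesis by (simp add: \<rho>_def field_simps power_divide)
    qed
    then have "close_params k u v \<subseteq> {x \<in> {1/2..0.668}. \<bar>\<Sum>i<n. of_int (a i) * x ^ i\<bar> \<le> \<rho>}"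
      unfolding close_params_def by auto
    moreover have "closed {x \<in> {1/2..0.668::real}. \<bar>\<Sum>i<n. of_int (a i) * x ^ i\<bar> \<le> \<rho>}"
      by (intro closed_Collect_conj closed_Collect_le continuous_intros) (simp flip: atLeastAtMost_iff)
    ultimately have "emeasure lborel (close_params k u v) \<le>
        emeasure lborel {x \<in> {1/2..0.668}. \<bar>\<Sum>i<n. of_int (a i) * x ^ i\<bar> \<le> \<rho>}"
      by (intro emeasure_mono) (auto intro: borel_closed)
    also have "\<dots> \<le> ennreal (C * \<rho>)"
      using n mu mv by (intro sub) (auto simp: a_def \<rho>_def)
    finally show ?thesis by (simp add: \<rho>_def mult_ac)
  qed
  show thesis
  proof (rule that[of "4 * C"])
    fix k m :: nat and u v
    assume *: "u \<subseteq> {..<k}" "v \<subseteq> {..<k}" "m < k" "\<And>i. i < m \<Longrightarrow> i \<in> u \<longleftrightarrow> i \<in> v" "(m \<in> u) \<noteq> (m \<in> v)"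
    show "emeasure lborel (close_params k u v) \<le> ennreal (4 * C * (2 ^ m / 2 ^ k))"
    proof (cases "m \<in> u")
      case True
      then show ?thesis using * by (intro main) auto
    next
      case False
      \<comment> \<open>If \<open>m\<close> lies in \<open>v\<close>, the constant coefficient would
        be -1; exchanging \<open>u\<close> and \<open>v\<close> makes it 1.\<close>
      then show ?thesis using * by (subst close_params_commute) (intro main; auto)
    qed
  qed (use C in auto)
qed

lemma close_params_measurable: "close_params k u v \<in> sets lborel"
proof -
  have "closed (close_params k u v)"
    unfolding close_params_def column_pos_def
    by (intro closed_Collect_conj closed_Collect_le continuous_intros) (simp flip: atLeastAtMost_iff)
  then show ?thesis by (simp add: borel_closed)
qed

section \<open>The integrated number of close pairs\<close>

text \<open>Such a \<open>v\<close> is determined by its part in \<open>{m..<k}\<close>.\<close>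

lemma card_agree_below:
  assumes "u \<subseteq> {..<k}" "m \<le> k"
  shows "card {v \<in> Pow {..<k}. \<forall>i<m. i \<in> u \<longleftrightarrow> i \<in> v} \<le> 2 ^ (k - m)"
proof -
  let ?V = "{v \<in> Pow {..<k}. \<forall>i<m. i \<in> u \<longleftrightarrow> i \<in> v}"
  have "inj_on (\<lambda>v. v \<inter> {m..<k}) ?V"
  proof (rule inj_onI, rule set_eqI)
    fix v w i assume "v \<in> ?V" "w \<in> ?V" and "v \<inter> {m..<k} = w \<inter> {m..<k}"
    then show "i \<in> v \<longleftrightarrow> i \<in> w" by (cases "i < m") (auto simp: set_eq_iff subset_eq not_less)
  qed
  then have "card ?V = card ((\<lambda>v. v \<inter> {m..<k}) ` ?V)" by (simp add: card_image)
  also have "\<dots> \<le> card (Pow {m..<k})" by (intro card_mono) auto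
  also have "\<dots> = 2 ^ (k - m)" by (simp add: card_Pow)
  finally show ?thesis .
qed

text \<open>For fixed \<open>u\<close>, at most 2^(k - m) sets \<open>v\<close> agree with it below
  \<open>m\<close>, and each costs \<open>C * 2^m / 2^k\<close>. So every \<open>m\<close>
  contributes at most \<open>C\<close>, and the diagonal at most 1.\<close>

lemma energy_bound:
  obtains C :: real where "C > 0"
    "\<And>k. (\<Sum>u\<in>Pow {..<k}. \<Sum>v\<in>Pow {..<k}. emeasure lborel (close_params k u v))
      \<le> ennreal (2 ^ k * (1 + C * k))"
proof -
  obtain C :: real where C: "C > 0" and
    close: "\<And>k m u v. u \<subseteq> {..<k} \<Longrightarrow> v \<subseteq> {..<k} \<Longrightarrow> m < k \<Longrightarrow> (\<And>i. i < m \<Longrightarrow> i \<in> u \<longleftrightarrow> i \<in> v) \<Longrightarrow>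
      (m \<in> u) \<noteq> (m \<in> v) \<Longrightarrow> emeasure lborel (close_params k u v) \<le> ennreal (C * (2 ^ m / 2 ^ k))"
    by (rule close_params_measure) blast
  show thesis
  proof (rule that[OF C])
    fix k
    \<comment> \<open>Summing over every \<open>m\<close> below which \<open>u\<close> and
      \<open>v\<close> agree, not only over their first difference, gives a majorant whose rows are
      easy to sum.\<close>
    define b where "b = (\<lambda>u v. of_bool (v = u) +
      (\<Sum>m<k. of_bool (\<forall>i<m. i \<in> u \<longleftrightarrow> i \<in> v) * (C * (2 ^ m / 2 ^ k))))"
    have b0: "b u v \<ge> 0" for u v
      using C by (auto simp: b_def intro!: add_nonneg_nonneg sum_nonneg)
    have le: "emeasure lborel (close_params k u v) \<le> ennreal (b u v)"
      if u: "u \<subseteq> {..<k}" and v: "v \<subseteq> {..<k}" for u v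
    proof (cases "v = u")
      case True
      have "emeasure lborel (close_params k u v) \<le> emeasure lborel {1/2..0.668::real}"
        by (intro emeasure_mono) (auto simp: close_params_def)
      also have "\<dots> \<le> ennreal 1" by (simp add: ennreal_leI)
      also have "\<dots> \<le> ennreal (b u v)"
        using True C by (intro ennreal_leI) (auto simp: b_def intro!: sum_nonneg)
      finally show ?thesis .
    next
      case False
      then have ex: "\<exists>m. (m \<in> u) \<noteq> (m \<in> v)" by auto
      define m where "m = (LEAST m. (m \<in> u) \<noteq> (m \<in> v))"
      have m: "(m \<in> u) \<noteq> (m \<in> v)" unfolding m_def by (rule LeastI_ex[OF ex])
      have lt: "i \<in> u \<longleftrightarrow> i \<in> v" if "i < m" for i
        using not_less_Least[of i "\<lambda>m. (m \<in> u) \<noteq> (m \<in> v)"] that by (auto simp: m_def)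
      have mk: "m < k" using m u v by auto
      have "emeasure lborel (close_params k u v) \<le> ennreal (C * (2 ^ m / 2 ^ k))"
        by (rule close[OF u v mk lt m])
      also have "C * (2 ^ m / 2 ^ k) = of_bool (\<forall>i<m. i \<in> u \<longleftrightarrow> i \<in> v) * (C * (2 ^ m / 2 ^ k))"
        using lt by simp
      also have "\<dots> \<le> (\<Sum>m<k. of_bool (\<forall>i<m. i \<in> u \<longleftrightarrow> i \<in> v) * (C * (2 ^ m / 2 ^ k)))"
        using mk C by (intro member_le_sum) auto
      also have "\<dots> = b u v" using False by (simp add: b_def)
      finally show ?thesis by (simp add: ennreal_leI)
    qed
    have row: "(\<Sum>v\<in>Pow {..<k}. b u v) \<le> 1 + C * k" if u: "u \<subseteq> {..<k}" for u
    proof -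
      have "(\<Sum>v\<in>Pow {..<k}. b u v) = (\<Sum>v\<in>Pow {..<k}. of_bool (v = u)) +
          (\<Sum>m<k. \<Sum>v\<in>Pow {..<k}. of_bool (\<forall>i<m. i \<in> u \<longleftrightarrow> i \<in> v) * (C * (2 ^ m / 2 ^ k)))"
        unfolding b_def sum.distrib by (subst sum.swap) simp
      also have "\<dots> \<le> 1 + (\<Sum>m<k. C)"
      proof (intro add_mono sum_mono)
        show "(\<Sum>v\<in>Pow {..<k}. of_bool (v = u)) \<le> (1::real)"
          by (simp add: of_bool_def sum.delta)
        fix m assume m: "m \<in> {..<k}"
        let ?V = "{v \<in> Pow {..<k}. \<forall>i<m. i \<in> u \<longleftrightarrow> i \<in> v}"
        have "(\<Sum>v\<in>Pow {..<k}. of_bool (\<forall>i<m. i \<in> u \<longleftrightarrow> i \<in> v) * (C * (2 ^ m / 2 ^ k))) =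
            (\<Sum>v\<in>?V. C * (2 ^ m / 2 ^ k))"
          by (rule sum.mono_neutral_cong_right) auto
        also have "\<dots> = real (card ?V) * (C * (2 ^ m / 2 ^ k))" by simp
        also have "\<dots> \<le> real (2 ^ (k - m)) * (C * (2 ^ m / 2 ^ k))"
          using card_agree_below[OF u, of m] m C by (intro mult_right_mono of_nat_mono) auto
        also have "\<dots> = C"
        proof -
          have "(2::real) ^ k = 2 ^ (k - m) * 2 ^ m" using m by (simp flip: power_add)
          then show ?thesis by simp
        qed
        finally show "(\<Sum>v\<in>Pow {..<k}. of_bool (\<forall>i<m. i \<in> u \<longleftrightarrow> i \<in> v) * (C * (2 ^ m / 2 ^ k))) \<le> C" .
      qed
      finally show ?thesis by (simp add: mult.commute)
    qed
    have "(\<Sum>u\<in>Pow {..<k}. \<Sum>v\<in>Pow {..<k}. emeasure lborel (close_params k u v)) \<le>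
        (\<Sum>u\<in>Pow {..<k}. \<Sum>v\<in>Pow {..<k}. ennreal (b u v))"
      by (intro sum_mono le) auto
    also have "\<dots> = ennreal (\<Sum>u\<in>Pow {..<k}. \<Sum>v\<in>Pow {..<k}. b u v)"
      using b0 by (simp add: sum_nonneg)
    also have "\<dots> \<le> ennreal (\<Sum>u\<in>Pow {..<k}. 1 + C * k)"
      by (intro ennreal_leI sum_mono row) auto
    also have "\<dots> = ennreal (2 ^ k * (1 + C * k))" by (simp add: card_Pow)
    finally show "(\<Sum>u\<in>Pow {..<k}. \<Sum>v\<in>Pow {..<k}. emeasure lborel (close_params k u v))
      \<le> ennreal (2 ^ k * (1 + C * k))" .
  qed
qed

section \<open>From integrated counts to almost every parameter\<close>

text \<open>The count is a sum of indicators, so its integral is the sum of the measures and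
  Markov's inequality applies.\<close>

lemma Markov_count:
  assumes P: "finite P" and A: "\<And>i. i \<in> P \<Longrightarrow> A i \<in> sets M" and \<Omega>: "\<Omega> \<in> sets M" and T: "T > 0" and S: "S \<ge> 0"
    and sum: "(\<Sum>i\<in>P. emeasure M (A i)) \<le> ennreal S"
  shows "{x \<in> \<Omega>. T \<le> real (card {i \<in> P. x \<in> A i})} \<in> sets M" (is "?B \<in> _")
    and "emeasure M {x \<in> \<Omega>. T \<le> real (card {i \<in> P. x \<in> A i})} \<le> ennreal (S / T)"
proof -
  have count: "real (card {i \<in> P. x \<in> A i}) = (\<Sum>i\<in>P. indicator (A i) x)" for x
    using P by (simp add: sum.inter_filter[symmetric] indicator_def of_bool_def)
  have count': "ennreal (card {i \<in> P. x \<in> A i}) = (\<Sum>i\<in>P. indicator (A i) x)" for x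
    by (simp add: count indicator_def of_bool_def flip: sum_ennreal) (intro sum.cong; simp)
  have "(\<lambda>x. \<Sum>i\<in>P. indicator (A i) x :: real) \<in> borel_measurable M"
    using A by (intro borel_measurable_sum borel_measurable_indicator) auto
  then have "{x \<in> space M. T \<le> (\<Sum>i\<in>P. indicator (A i) x)} \<in> sets M"
    by measurable
  moreover have "?B = \<Omega> \<inter> {x \<in> space M. T \<le> (\<Sum>i\<in>P. indicator (A i) x)}"
    using sets.sets_into_space[OF \<Omega>] by (auto simp: count)
  ultimately show "?B \<in> sets M" using \<Omega> by auto
  have "?B = {x \<in> \<Omega>. 1 \<le> ennreal (1 / T) * (\<Sum>i\<in>P. indicator (A i) x)}"
    using T by (auto simp: field_simps simp flip: count' ennreal_mult'' ennreal_1)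
  also have "emeasure M \<dots> \<le> ennreal (1 / T) * (\<integral>\<^sup>+ x. (\<Sum>i\<in>P. indicator (A i) x) * indicator \<Omega> x \<partial>M)"
    using A \<Omega> by (intro nn_integral_Markov_inequality) auto
  also have "\<dots> \<le> ennreal (1 / T) * (\<integral>\<^sup>+ x. (\<Sum>i\<in>P. indicator (A i) x) \<partial>M)"
    by (intro mult_left_mono nn_integral_mono) (auto simp: indicator_def)
  also have "(\<integral>\<^sup>+ x. (\<Sum>i\<in>P. indicator (A i) x) \<partial>M) = (\<Sum>i\<in>P. emeasure M (A i))"
    using A by (simp add: nn_integral_sum)
  also have "ennreal (1 / T) * \<dots> \<le> ennreal (1 / T) * ennreal S"
    by (intro mult_left_mono sum) auto
  also have "\<dots> = ennreal (S / T)" using T S by (simp flip: ennreal_mult)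
  finally show "emeasure M ?B \<le> ennreal (S / T)" .
qed

definition close_pairs :: "real \<Rightarrow> nat \<Rightarrow> (nat set \<times> nat set) set" where
  "close_pairs lam k = {(u, v) \<in> Pow {..<k} \<times> Pow {..<k}.
     \<bar>column_pos lam u - column_pos lam v\<bar> \<le> (1/2) ^ k}"

text \<open>The integrated count is at most 2^k (1 + C k). Against the threshold k^3 2^k, Markov
  leaves exceptional sets of measure at most (1 + C) / k^2, which is summable, and Borel-Cantelli
  concludes.\<close>

lemma AE_close_pairs:
  "AE lam in lborel. lam \<in> {1/2..0.668} \<longrightarrow>
     (\<forall>\<^sub>F k in sequentially. real (card (close_pairs lam k)) < real k ^ 3 * 2 ^ k)"
proof -
  obtain C :: real where C: "C > 0" and
    energy: "\<And>k. (\<Sum>u\<in>Pow {..<k}. \<Sum>v\<in>Pow {..<k}. emeasure lborel (close_params k u v))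
      \<le> ennreal (2 ^ k * (1 + C * k))"
    by (rule energy_bound) blast
  define I where "I = {1/2..0.668::real}"
  define P where "P = (\<lambda>k::nat. Pow {..<k} \<times> Pow {..<k})"
  define B where "B = (\<lambda>k. {x \<in> I. real k ^ 3 * 2 ^ k \<le>
    real (card {i \<in> P k. x \<in> (\<lambda>(u, v). close_params k u v) i})})"
  have I: "I \<in> sets lborel" by (simp add: I_def)
  have B: "B k \<in> sets lborel \<and> emeasure lborel (B k) \<le> ennreal ((1 + C) / real k ^ 2)" if k: "k \<ge> 1" for k
  proof -
    have T: "real k ^ 3 * 2 ^ k > 0" using k by simp
    have S: "0 \<le> 2 ^ k * (1 + C * k)" using C by simp
    have sum: "(\<Sum>i\<in>P k. emeasure lborel ((\<lambda>(u, v). close_params k u v) i)) \<le> ennreal (2 ^ k * (1 + C * k))"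
      using energy[of k] by (simp add: P_def sum.cartesian_product case_prod_unfold)
    have fin: "finite (P k)" by (simp add: P_def)
    have ms: "(\<lambda>(u, v). close_params k u v) i \<in> sets lborel" for i
      using close_params_measurable by (simp add: case_prod_unfold)
    note M = Markov_count[OF fin ms I T S sum]
    have "1 + C * k \<le> (1 + C) * k" using k by (simp add: algebra_simps)
    then have "2 ^ k * (1 + C * k) / (real k ^ 3 * 2 ^ k) \<le> (1 + C) * k / real k ^ 3"
      using k by (simp add: divide_right_mono)
    also have "\<dots> = (1 + C) / real k ^ 2" using k by (simp add: power3_eq_cube power2_eq_square)
    finally have "2 ^ k * (1 + C * k) / (real k ^ 3 * 2 ^ k) \<le> (1 + C) / real k ^ 2" .
    then have "emeasure lborel (B k) \<le> ennreal ((1 + C) / real k ^ 2)"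
      unfolding B_def by (rule order_trans[OF M(2) ennreal_leI])
    then show ?thesis using M(1) unfolding B_def by blast
  qed
  \<comment> \<open>At \<open>k = 0\<close> the threshold is 0, so \<open>B 0\<close> is all of
    \<open>I\<close>.\<close>
  have Bm: "B k \<in> sets lborel" for k
    using B[of k] I by (cases "k \<ge> 1") (auto simp: B_def not_le)
  have "B k \<subseteq> I" for k by (auto simp: B_def)
  then have "emeasure lborel (B k) \<le> emeasure lborel I" for k using I by (intro emeasure_mono) auto
  moreover have "emeasure lborel I < \<infinity>" by (simp add: I_def)
  ultimately have Bf: "emeasure lborel (B k) < \<infinity>" for k by (meson le_less_trans)
  have sm: "summable (\<lambda>k. measure lborel (B k))"
  proof (rule summable_comparison_test_ev)
    show "\<forall>\<^sub>F k in sequentially. norm (measure lborel (B k)) \<le> (1 + C) * inverse (real k ^ 2)"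
      using eventually_ge_at_top[of 1]
    proof eventually_elim
      case (elim k)
      have "measure lborel (B k) \<le> (1 + C) / real k ^ 2"
        unfolding measure_def using B[OF elim] C by (intro enn2real_leI) auto
      then show ?case by (simp add: divide_inverse)
    qed
    show "summable (\<lambda>k. (1 + C) * inverse (real k ^ 2))"
      by (intro summable_mult inverse_power_summable) simp
  qed
  have "{i \<in> P k. lam \<in> (\<lambda>(u, v). close_params k u v) i} = close_pairs lam k" if "lam \<in> I" for lam k
    using that by (auto simp: P_def I_def close_params_def close_pairs_def)
  then have eq: "lam \<in> B k \<longleftrightarrow> real k ^ 3 * 2 ^ k \<le> real (card (close_pairs lam k))" if "lam \<in> I" for lam k
    using that by (simp add: B_def)
  have "AE lam in lborel. eventually (\<lambda>k. lam \<in> space lborel - B k) sequentially"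
    by (rule borel_cantelli_AE1[OF Bm Bf sm])
  then show ?thesis
  proof (rule AE_mp, intro AE_I2 impI)
    fix lam assume ev: "\<forall>\<^sub>F k in sequentially. lam \<in> space lborel - B k" and "lam \<in> {1/2..0.668::real}"
    then have lam: "lam \<in> I" by (simp add: I_def)
    from ev show "\<forall>\<^sub>F k in sequentially. real (card (close_pairs lam k)) < real k ^ 3 * 2 ^ k"
      by eventually_elim (use eq[OF lam] in \<open>auto simp: not_le\<close>)
  qed
qed

subsection \<open>The condensation attractor as a comb\<close>

lemma column_pos_bounds:
  assumes "w \<subseteq> {..<k}" "0 \<le> lam" "lam < 1"
  shows "0 \<le> column_pos lam w" "column_pos lam w \<le> 1"
proof -
  show "0 \<le> column_pos lam w"
    using assms by (auto simp: column_pos_def intro!: mult_nonneg_nonneg sum_nonneg)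
  have "(\<Sum>i\<in>w. lam ^ i) \<le> (\<Sum>i<k. lam ^ i)" using assms by (intro sum_mono2) auto
  then have "column_pos lam w \<le> (1 - lam) * (\<Sum>i<k. lam ^ i)"
    unfolding column_pos_def using assms by (intro mult_left_mono) auto
  also have "\<dots> = 1 - lam ^ k" by (rule one_diff_power_eq[symmetric])
  also have "\<dots> \<le> 1" using assms by simp
  finally show "column_pos lam w \<le> 1" .
qed

text \<open>Applying \<open>S0\<close> on the outside shifts all positions by one; applying
  \<open>S1\<close> shifts them and adds position 0.\<close>

lemma column_pos_Suc: "column_pos lam (Suc ` w) = lam * column_pos lam w"
  by (simp add: column_pos_def sum.reindex sum_distrib_left mult_ac)

lemma column_pos_insert_Suc:
  assumes "finite w"
  shows "column_pos lam (insert 0 (Suc ` w)) = lam * column_pos lam w + (1 - lam)"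
proof -
  have "column_pos lam (insert 0 (Suc ` w)) = (1 - lam) + column_pos lam (Suc ` w)"
    using assms by (simp add: column_pos_def algebra_simps)
  then show ?thesis by (simp add: column_pos_Suc)
qed

definition teeth :: "real \<Rightarrow> nat \<Rightarrow> (real \<times> real) set" where
  "teeth lam k = (\<Union>w\<in>Pow {..<k}. {column_pos lam w} \<times> {0..lam ^ k})"

text \<open>For \<open>lam \<ge> 1/2\<close> the base is the attractor of \<open>S0\<close> and
  \<open>S1\<close> without condensation. Adding it makes the union of the teeth closed.\<close>

definition comb :: "real \<Rightarrow> (real \<times> real) set" where
  "comb lam = {0..1} \<times> {0} \<union> (\<Union>k. teeth lam k)"

lemma teeth_0: "teeth lam 0 = condensation_set"
  by (simp add: teeth_def condensation_set_def column_pos_def)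

lemma S0_image: "lam > 0 \<Longrightarrow> S0 lam ` ({x} \<times> {0..h}) = {lam * x} \<times> {0..lam * h}"
proof (intro equalityI subsetI)
  fix z assume lam: "lam > 0" and "z \<in> {lam * x} \<times> {0..lam * h}"
  then have "z = S0 lam (x, snd z / lam)" "(x, snd z / lam) \<in> {x} \<times> {0..h}"
    by (auto simp: S0_def field_simps)
  then show "z \<in> S0 lam ` ({x} \<times> {0..h})" by blast
qed (auto simp: S0_def mult_left_mono)

lemma S1_eq: "S1 lam z = S0 lam z + (1 - lam, 0)"
  by (simp add: S0_def S1_def)

lemma S1_image: "lam > 0 \<Longrightarrow> S1 lam ` ({x} \<times> {0..h}) = {lam * x + (1 - lam)} \<times> {0..lam * h}"
proof -
  assume "lam > 0"
  then have "S1 lam ` ({x} \<times> {0..h}) = (\<lambda>z. z + (1 - lam, 0)) ` ({lam * x} \<times> {0..lam * h})"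
    by (simp add: S0_image[symmetric] image_image S1_eq)
  also have "\<dots> = {lam * x + (1 - lam)} \<times> {0..lam * h}"
    by (force simp: image_iff)
  finally show ?thesis .
qed

lemma Pow_lessThan_Suc_shift:
  "Pow {..<Suc k} = (\<lambda>w. Suc ` w) ` Pow {..<k} \<union> (\<lambda>w. insert 0 (Suc ` w)) ` Pow {..<k}"
proof (intro equalityI subsetI)
  fix w assume w: "w \<in> Pow {..<Suc k}"
  define v where "v = {i. Suc i \<in> w}"
  have v: "v \<in> Pow {..<k}" using w by (auto simp: v_def)
  have "w = (if 0 \<in> w then insert 0 (Suc ` v) else Suc ` v)"
  proof (rule set_eqI)
    fix i show "i \<in> w \<longleftrightarrow> i \<in> (if 0 \<in> w then insert 0 (Suc ` v) else Suc ` v)"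
      by (cases i) (auto simp: v_def)
  qed
  then show "w \<in> (\<lambda>w. Suc ` w) ` Pow {..<k} \<union> (\<lambda>w. insert 0 (Suc ` w)) ` Pow {..<k}"
    using v by (metis Un_iff image_eqI)
qed auto

lemma teeth_Suc:
  assumes "lam > 0"
  shows "teeth lam (Suc k) = S0 lam ` teeth lam k \<union> S1 lam ` teeth lam k"
proof -
  have fin: "finite w" if "w \<in> Pow {..<k}" for w using that by (auto intro: finite_subset)
  have "teeth lam (Suc k) = (\<Union>w\<in>Pow {..<k}. {lam * column_pos lam w} \<times> {0..lam * lam ^ k}) \<union>
      (\<Union>w\<in>Pow {..<k}. {lam * column_pos lam w + (1 - lam)} \<times> {0..lam * lam ^ k})"
    unfolding teeth_def Pow_lessThan_Suc_shift using fin
    by (simp add: column_pos_Suc column_pos_insert_Suc del: Pow_iff)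
  also have "\<dots> = S0 lam ` teeth lam k \<union> S1 lam ` teeth lam k"
    unfolding teeth_def image_UN S0_image[OF assms] S1_image[OF assms] ..
  finally show ?thesis .
qed

text \<open>Since \<open>lam \<ge> 1/2\<close>, the intervals [0, lam] and [1 - lam, 1] cover
  [0, 1], so the base reproduces itself. The maps raise the level of every tooth by one, and C
  supplies level 0.\<close>

lemma comb_invariant:
  assumes "1/2 \<le> lam" "lam < 1"
  shows "comb lam = S0 lam ` comb lam \<union> S1 lam ` comb lam \<union> condensation_set"
proof -
  let ?B = "{0..1::real} \<times> {0::real}"
  have "z \<in> S0 lam ` ?B \<union> S1 lam ` ?B" if "z \<in> ?B" for z
  proof (cases "fst z \<le> lam")
    case True
    then have "z = S0 lam (fst z / lam, 0)" "(fst z / lam, 0) \<in> ?B"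
      using that assms by (auto simp: S0_def)
    then show ?thesis by blast
  next
    case False
    then have "z = S1 lam ((fst z - (1 - lam)) / lam, 0)" "((fst z - (1 - lam)) / lam, 0) \<in> ?B"
      using that assms by (auto simp: S1_def field_simps)
    then show ?thesis by blast
  qed
  moreover have "S0 lam ` ?B \<subseteq> ?B"
    using assms by (auto simp: S0_def mult_le_one)
  moreover have "S1 lam ` ?B \<subseteq> ?B"
    using assms by (auto simp: S1_def)
  ultimately have base: "?B = S0 lam ` ?B \<union> S1 lam ` ?B" by blast
  have "(\<Union>k. teeth lam k) = teeth lam 0 \<union> (\<Union>k. teeth lam (Suc k))"
    by (metis UNIV_nat_eq UN_insert UN_simps(10))
  also have "\<dots> = condensation_set \<union> (S0 lam ` (\<Union>k. teeth lam k) \<union> S1 lam ` (\<Union>k. teeth lam k))"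
    using assms by (simp add: teeth_0 teeth_Suc image_UN UN_Un_distrib)
  finally have cols: "(\<Union>k. teeth lam k) =
    condensation_set \<union> (S0 lam ` (\<Union>k. teeth lam k) \<union> S1 lam ` (\<Union>k. teeth lam k))" .
  show ?thesis
    unfolding comb_def image_Un using base cols by blast
qed

text \<open>An outer approximation: levels below \<open>K\<close> are kept exactly and all later
  ones are enclosed in a strip. It serves both the closedness of the comb and the upper box
  count.\<close>

definition comb_cover :: "real \<Rightarrow> nat \<Rightarrow> (real \<times> real) set" where
  "comb_cover lam K = {0..1} \<times> {0..lam ^ K} \<union> (\<Union>k<K. teeth lam k)"

lemma teeth_subset:
  assumes "0 < lam" "lam < 1" "K \<le> k"
  shows "teeth lam k \<subseteq> {0..1} \<times> {0..lam ^ K}"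
proof -
  have "lam ^ k \<le> lam ^ K" using assms by (intro power_decreasing) auto
  moreover have "0 \<le> column_pos lam w" "column_pos lam w \<le> 1" if "w \<subseteq> {..<k}" for w
    using column_pos_bounds[OF that] assms by auto
  ultimately show ?thesis by (auto simp: teeth_def intro: order_trans)
qed

lemma comb_subset_cover:
  assumes "0 < lam" "lam < 1"
  shows "comb lam \<subseteq> comb_cover lam K"
proof -
  have "teeth lam k \<subseteq> comb_cover lam K" for k
  proof (cases "k < K")
    case False
    then show ?thesis using teeth_subset[of lam K k] assms by (auto simp: comb_cover_def)
  qed (auto simp: comb_cover_def)
  then show ?thesis using assms by (auto simp: comb_def comb_cover_def)
qed

text \<open>A point of every cover that lies on no tooth has height at most lam^K for all K, hence
  is on the base. This presents the comb as an intersection of closed sets.\<close>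

lemma comb_eq_Inter_cover:
  assumes "0 < lam" "lam < 1"
  shows "comb lam = (\<Inter>K. comb_cover lam K)"
proof
  show "comb lam \<subseteq> (\<Inter>K. comb_cover lam K)" using comb_subset_cover[OF assms] by blast
  show "(\<Inter>K. comb_cover lam K) \<subseteq> comb lam"
  proof
    fix z assume z: "z \<in> (\<Inter>K. comb_cover lam K)"
    show "z \<in> comb lam"
    proof (cases "z \<in> (\<Union>k. teeth lam k)")
      case False
      then have all: "z \<in> {0..1} \<times> {0..lam ^ K}" for K using z by (auto simp: comb_cover_def)
      have "snd z \<le> 0"
      proof (rule LIMSEQ_le_const)
        show "(\<lambda>K. lam ^ K) \<longlonglongrightarrow> 0" using assms by (intro LIMSEQ_realpow_zero) auto
        show "\<exists>N. \<forall>n\<ge>N. snd z \<le> lam ^ n" using all by (auto simp: mem_Times_iff)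
      qed
      then show ?thesis using all[of 0] by (auto simp: comb_def)
    qed (auto simp: comb_def)
  qed
qed

lemma comb_subset_unit_square:
  assumes "0 < lam" "lam < 1"
  shows "comb lam \<subseteq> unit_square"
  using comb_subset_cover[OF assms, of 0] by (simp add: comb_cover_def unit_square_def)

lemma comb_compact:
  assumes "0 < lam" "lam < 1"
  shows "compact (comb lam)"
proof -
  have "closed (teeth lam k)" for k
    unfolding teeth_def by (intro closed_UN) (auto intro: closed_Times)
  then have "closed (comb_cover lam K)" for K
    unfolding comb_cover_def by (intro closed_Un closed_UN closed_Times) auto
  then have "closed (comb lam)" unfolding comb_eq_Inter_cover[OF assms] by (intro closed_INT) auto
  moreover have "bounded (comb lam)"
    by (rule bounded_subset[OF _ comb_subset_unit_square[OF assms]])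
      (simp add: unit_square_def bounded_Times)
  ultimately show ?thesis by (simp add: compact_eq_bounded_closed)
qed

section \<open>Uniqueness of the invariant compact set\<close>

text \<open>The point of \<open>G\<close> nearest to \<open>y\<close> is mapped into
  \<open>G\<close> again, and both maps scale distances by \<open>lam\<close>.\<close>

lemma infdist_S0_S1:
  assumes "0 < lam" "G \<noteq> {}" "closed G" "S0 lam ` G \<union> S1 lam ` G \<subseteq> G"
  shows "infdist (S0 lam y) G \<le> lam * infdist y G" "infdist (S1 lam y) G \<le> lam * infdist y G"
proof -
  obtain g where g: "g \<in> G" "infdist y G = dist y g"
    using infdist_attains_inf assms by blast
  have "dist (S0 lam y) (S0 lam g) = lam * dist y g"
    using assms by (simp add: S0_def dist_norm flip: scaleR_diff_right)
  moreover have "dist (S1 lam y) (S1 lam g) = dist (S0 lam y) (S0 lam g)"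
    by (simp add: S1_eq dist_norm)
  ultimately show "infdist (S0 lam y) G \<le> lam * infdist y G" "infdist (S1 lam y) G \<le> lam * infdist y G"
    using infdist_le[of "S0 lam g" G "S0 lam y"] infdist_le[of "S1 lam g" G "S1 lam y"] g assms(4)
    by auto
qed

text \<open>A point of \<open>F\<close> lies in C, hence in \<open>G\<close>, or is the image of a
  point of \<open>F\<close>. Each unfolding thus multiplies the bound on the distance to
  \<open>G\<close> by \<open>lam\<close>. With one-sided inclusions as hypotheses, the lemma applies
  to two invariant sets in either order.\<close>

lemma invariant_set_subset:
  assumes lam: "0 < lam" "lam < 1" and F: "bounded F" "F \<subseteq> S0 lam ` F \<union> S1 lam ` F \<union> condensation_set"
    and G: "G \<noteq> {}" "closed G" "S0 lam ` G \<union> S1 lam ` G \<union> condensation_set \<subseteq> G"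
  shows "F \<subseteq> G"
proof -
  obtain g0 where g0: "g0 \<in> G" using G by blast
  obtain B0 where B0: "\<And>x. x \<in> F \<Longrightarrow> dist g0 x \<le> B0"
    using F(1) bounded_any_center[of F g0] by blast
  define B where "B = max B0 0"
  have le: "infdist x G \<le> lam ^ n * B" if "x \<in> F" for x n
    using that
  proof (induction n arbitrary: x)
    case 0
    then show ?case using infdist_le[OF g0, of x] B0[of x] by (simp add: B_def dist_commute)
  next
    case (Suc n)
    note contr = infdist_S0_S1[OF lam(1) G(1,2)]
    have sub: "S0 lam ` G \<union> S1 lam ` G \<subseteq> G" using G(3) by blast
    consider y where "y \<in> F" "x = S0 lam y" | y where "y \<in> F" "x = S1 lam y" | "x \<in> G"
      using Suc.prems F(2) G(3) by blast
    then show ?case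
    proof cases
      case 1
      have "infdist x G \<le> lam * infdist y G" using contr(1)[OF sub] 1 by simp
      also have "\<dots> \<le> lam * (lam ^ n * B)" using Suc.IH[OF 1(1)] lam by (intro mult_left_mono) auto
      finally show ?thesis by simp
    next
      case 2
      have "infdist x G \<le> lam * infdist y G" using contr(2)[OF sub] 2 by simp
      also have "\<dots> \<le> lam * (lam ^ n * B)" using Suc.IH[OF 2(1)] lam by (intro mult_left_mono) auto
      finally show ?thesis by simp
    next
      case 3
      then show ?thesis using lam by (simp add: B_def)
    qed
  qed
  show ?thesis
  proof
    fix x assume x: "x \<in> F"
    have "infdist x G \<le> 0"
    proof (rule LIMSEQ_le_const)
      show "(\<lambda>n. lam ^ n * B) \<longlonglongrightarrow> 0"
        using lam by (intro tendsto_mult_left_zero LIMSEQ_realpow_zero) auto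
      show "\<exists>N. \<forall>n\<ge>N. infdist x G \<le> lam ^ n * B" using le[OF x] by blast
    qed
    then have "infdist x G = 0" using infdist_nonneg[of x G] by linarith
    then show "x \<in> G" using in_closed_iff_infdist_zero G by blast
  qed
qed

lemma F_C_eq_comb:
  assumes "1/2 \<le> lam" "lam < 1"
  shows "F_C lam = comb lam"
  unfolding F_C_def
proof (rule the_equality)
  have lam: "0 < lam" using assms by simp
  have ne: "comb lam \<noteq> {}" by (auto simp: comb_def)
  have inv: "comb lam = S0 lam ` comb lam \<union> S1 lam ` comb lam \<union> condensation_set"
    by (rule comb_invariant[OF assms])
  note cpt = comb_compact[OF lam assms(2)]
  show "comb lam \<noteq> {} \<and> compact (comb lam) \<and> comb lam \<subseteq> unit_square \<and>
      comb lam = S0 lam ` comb lam \<union> S1 lam ` comb lam \<union> condensation_set"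
    by (intro conjI ne inv cpt comb_subset_unit_square lam assms(2))
  note sub = equalityD1[OF inv] equalityD2[OF inv]
  fix F assume F: "F \<noteq> {} \<and> compact F \<and> F \<subseteq> unit_square \<and>
    F = S0 lam ` F \<union> S1 lam ` F \<union> condensation_set"
  note inv_F = conjunct2[OF conjunct2[OF conjunct2[OF F]]]
  note F = conjunct1[OF F] conjunct1[OF conjunct2[OF F]] equalityD1[OF inv_F] equalityD2[OF inv_F]
  show "F = comb lam"
  proof
    show "F \<subseteq> comb lam"
      by (rule invariant_set_subset[OF lam assms(2) compact_imp_bounded[OF F(2)] F(3) ne
            compact_imp_closed[OF cpt] sub(2)])
    show "comb lam \<subseteq> F"
      by (rule invariant_set_subset[OF lam assms(2) compact_imp_bounded[OF cpt] sub(1) F(1)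
            compact_imp_closed[OF F(2)] F(4)])
  qed
qed

subsection \<open>Box counting\<close>

text \<open>Half-open cubes partition the plane, so counting the cubes that meet a set becomes
  taking the cardinality of its image under this map.\<close>

definition mesh_index :: "real \<Rightarrow> real \<times> real \<Rightarrow> int \<times> int" where
  "mesh_index \<delta> z = (\<lfloor>fst z / \<delta>\<rfloor>, \<lfloor>snd z / \<delta>\<rfloor>)"

lemma mem_mesh_cube_iff: "\<delta> > 0 \<Longrightarrow> z \<in> mesh_cube \<delta> ij \<longleftrightarrow> mesh_index \<delta> z = ij"
  by (auto simp: mesh_cube_def mesh_index_def floor_eq_iff mem_Times_iff prod_eq_iff field_simps)

lemma N_mesh_eq_card_image:
  assumes "\<delta> > 0"
  shows "N_mesh \<delta> E = card (mesh_index \<delta> ` E)"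
proof -
  have "mesh_cube \<delta> ij \<inter> E \<noteq> {} \<longleftrightarrow> ij \<in> mesh_index \<delta> ` E" for ij
    unfolding disjoint_iff image_iff by (metis mem_mesh_cube_iff[OF assms])
  then show ?thesis by (simp add: N_mesh_def)
qed

lemma mesh_index_rectangle:
  assumes "\<delta> > 0" "a \<ge> 0"
  shows "finite (mesh_index \<delta> ` ({0..a} \<times> {0..h}))"
    "h \<ge> 0 \<Longrightarrow> real (card (mesh_index \<delta> ` ({0..a} \<times> {0..h}))) \<le> (a / \<delta> + 1) * (h / \<delta> + 1)"
proof -
  have sub: "mesh_index \<delta> ` ({0..a} \<times> {0..h}) \<subseteq> {0..\<lfloor>a / \<delta>\<rfloor>} \<times> {0..\<lfloor>h / \<delta>\<rfloor>}"
    using assms by (auto simp: mesh_index_def intro!: floor_mono divide_right_mono)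
  then show "finite (mesh_index \<delta> ` ({0..a} \<times> {0..h}))" by (rule finite_subset) auto
  assume h: "h \<ge> 0"
  have "card (mesh_index \<delta> ` ({0..a} \<times> {0..h})) \<le> card ({0..\<lfloor>a / \<delta>\<rfloor>} \<times> {0..\<lfloor>h / \<delta>\<rfloor>})"
    by (rule card_mono[OF _ sub]) auto
  also have "\<dots> = nat (\<lfloor>a / \<delta>\<rfloor> + 1) * nat (\<lfloor>h / \<delta>\<rfloor> + 1)" by (simp add: card_cartesian_product)
  finally have "real (card (mesh_index \<delta> ` ({0..a} \<times> {0..h}))) \<le>
      real (nat (\<lfloor>a / \<delta>\<rfloor> + 1) * nat (\<lfloor>h / \<delta>\<rfloor> + 1))" by (rule of_nat_mono)
  also have "\<dots> = of_int (\<lfloor>a / \<delta>\<rfloor> + 1) * of_int (\<lfloor>h / \<delta>\<rfloor> + 1)"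
    using assms h by simp
  also have "\<dots> \<le> (a / \<delta> + 1) * (h / \<delta> + 1)"
    using assms h by (intro mult_mono) auto
  finally show "real (card (mesh_index \<delta> ` ({0..a} \<times> {0..h}))) \<le> (a / \<delta> + 1) * (h / \<delta> + 1)" .
qed

lemma mesh_index_segment:
  assumes "\<delta> > 0"
  shows "mesh_index \<delta> ` ({x} \<times> {0..h}) = {\<lfloor>x / \<delta>\<rfloor>} \<times> {0..\<lfloor>h / \<delta>\<rfloor>}"
proof (intro equalityI subsetI)
  fix ij assume "ij \<in> {\<lfloor>x / \<delta>\<rfloor>} \<times> {0..\<lfloor>h / \<delta>\<rfloor>}"
  then have ij: "fst ij = \<lfloor>x / \<delta>\<rfloor>" "0 \<le> snd ij" "snd ij \<le> \<lfloor>h / \<delta>\<rfloor>" by auto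
  have "of_int (snd ij) \<le> h / \<delta>" using ij(3) by (simp add: le_floor_iff)
  \<comment> \<open>The witness in each box is the point of the segment on the lower edge of that
    box.\<close>
  then have "(x, of_int (snd ij) * \<delta>) \<in> {x} \<times> {0..h}" using ij assms by (auto simp: field_simps)
  moreover have "ij = mesh_index \<delta> (x, of_int (snd ij) * \<delta>)"
    using ij assms by (simp add: mesh_index_def prod_eq_iff)
  ultimately show "ij \<in> mesh_index \<delta> ` ({x} \<times> {0..h})" by blast
qed (use assms in \<open>auto simp: mesh_index_def intro!: floor_mono divide_right_mono\<close>)

text \<open>At a level k < K each of the 2^k teeth meets at most lam^k 2^K + 1 boxes; as 2 lam \<ge>
  1, the level costs at most 2 (4 lam)^K. The strip with everything else costs at most 4 (4 lam)^K.
  Finiteness is recorded because \<open>card\<close> of an infinite set is 0.\<close>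

lemma N_mesh_comb_upper:
  assumes lam: "1/2 \<le> lam" "lam < 1" and \<delta>: "\<delta> > 0" "1 / \<delta> \<le> 2 ^ K"
  shows "finite (mesh_index \<delta> ` comb lam)"
    and "real (N_mesh \<delta> (comb lam)) \<le> (2 * real K + 4) * (4 * lam) ^ K"
proof -
  let ?R = "mesh_index \<delta> ` ({0..1} \<times> {0..lam ^ K})"
  have four: "(4 * lam) ^ k = 2 ^ k * (2 * lam) ^ k" for k
    by (subst power_mult_distrib[symmetric]) simp
  have two: "1 \<le> (2 * lam) ^ k" for k using lam by (intro one_le_power) auto
  have h: "lam ^ k / \<delta> \<le> lam ^ k * 2 ^ K" for k
    using mult_left_mono[OF \<delta>(2), of "lam ^ k"] lam by simp
  have R: "real (card ?R) \<le> 4 * (4 * lam) ^ K"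
  proof -
    have "real (card ?R) \<le> (1 / \<delta> + 1) * (lam ^ K / \<delta> + 1)"
      using lam \<delta> by (intro mesh_index_rectangle(2)) auto
    also have "\<dots> \<le> (2 * 2 ^ K) * (2 * (2 * lam) ^ K)"
    proof (intro mult_mono)
      have "(1::real) \<le> 2 ^ K" by simp
      then show "1 / \<delta> + 1 \<le> 2 * 2 ^ K" using \<delta> by linarith
      have "lam ^ K * 2 ^ K = (2 * lam) ^ K" by (simp add: power_mult_distrib)
      then show "lam ^ K / \<delta> + 1 \<le> 2 * (2 * lam) ^ K" using h[of K] two[of K] by linarith
    qed (use lam \<delta> in auto)
    also have "\<dots> = 4 * (4 * lam) ^ K" unfolding four by (simp only: mult_ac; simp)
    finally show ?thesis .
  qed
  have T: "finite (mesh_index \<delta> ` teeth lam k) \<and>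
      real (card (mesh_index \<delta> ` teeth lam k)) \<le> 2 * (4 * lam) ^ K" if k: "k < K" for k
  proof -
    have eq: "mesh_index \<delta> ` teeth lam k = (\<Union>w\<in>Pow {..<k}. {\<lfloor>column_pos lam w / \<delta>\<rfloor>} \<times> {0..\<lfloor>lam ^ k / \<delta>\<rfloor>})"
      unfolding teeth_def image_UN mesh_index_segment[OF \<delta>(1)] ..
    have "card (mesh_index \<delta> ` teeth lam k) \<le>
        (\<Sum>w\<in>Pow {..<k}. card ({\<lfloor>column_pos lam w / \<delta>\<rfloor>} \<times> {0..\<lfloor>lam ^ k / \<delta>\<rfloor>}))"
      unfolding eq by (intro card_UN_le) auto
    also have "\<dots> = 2 ^ k * nat (\<lfloor>lam ^ k / \<delta>\<rfloor> + 1)"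
      by (simp add: card_cartesian_product card_Pow)
    finally have "real (card (mesh_index \<delta> ` teeth lam k)) \<le> real (2 ^ k * nat (\<lfloor>lam ^ k / \<delta>\<rfloor> + 1))"
      by (rule of_nat_mono)
    also have "\<dots> = 2 ^ k * of_int (\<lfloor>lam ^ k / \<delta>\<rfloor> + 1)" using lam \<delta> by simp
    also have "\<dots> \<le> 2 ^ k * (lam ^ k * 2 ^ K + 1)"
      using order_trans[OF of_int_floor_le h[of k]] by (intro mult_left_mono) auto
    also have "\<dots> = 2 ^ K * (2 * lam) ^ k + 2 ^ k * 1" by (simp add: power_mult_distrib algebra_simps)
    also have "\<dots> \<le> 2 ^ K * (2 * lam) ^ K + 2 ^ K * (2 * lam) ^ K"
      using k lam two by (intro add_mono mult_mono power_increasing) auto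
    also have "\<dots> = 2 * (4 * lam) ^ K" unfolding four by simp
    finally show ?thesis by (auto simp: eq)
  qed
  have fin: "finite (mesh_index \<delta> ` comb_cover lam K)"
    unfolding comb_cover_def image_Un image_UN using T \<delta> by (auto intro: mesh_index_rectangle(1))
  have sub: "mesh_index \<delta> ` comb lam \<subseteq> mesh_index \<delta> ` comb_cover lam K"
    using lam by (intro image_mono comb_subset_cover) auto
  show "finite (mesh_index \<delta> ` comb lam)" by (rule finite_subset[OF sub fin])
  have "card (mesh_index \<delta> ` comb lam) \<le> card (mesh_index \<delta> ` comb_cover lam K)"
    by (rule card_mono[OF fin sub])
  also have "\<dots> \<le> card ?R + card (\<Union>k<K. mesh_index \<delta> ` teeth lam k)"
    unfolding comb_cover_def image_Un image_UN by (rule card_Un_le)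
  also have "\<dots> \<le> card ?R + (\<Sum>k<K. card (mesh_index \<delta> ` teeth lam k))"
    by (intro add_left_mono card_UN_le) auto
  finally have "real (card (mesh_index \<delta> ` comb lam)) \<le>
      real (card ?R) + (\<Sum>k<K. real (card (mesh_index \<delta> ` teeth lam k)))"
    by (simp flip: of_nat_sum of_nat_add)
  also have "\<dots> \<le> 4 * (4 * lam) ^ K + (\<Sum>k<K. 2 * (4 * lam) ^ K)"
    using T by (intro add_mono R sum_mono) auto
  finally show "real (N_mesh \<delta> (comb lam)) \<le> (2 * real K + 4) * (4 * lam) ^ K"
    by (simp add: N_mesh_eq_card_image \<delta> algebra_simps)
qed

section \<open>The lower count and the dimension\<close>

text \<open>Cauchy-Schwarz for the fibre sizes of \<open>f\<close>: they add up to
  \<open>card W\<close>, and their squares add up to the number of collisions.\<close>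

lemma card_sq_le_image_times_collisions:
  fixes f :: "'a \<Rightarrow> 'b"
  assumes "finite W"
  shows "(real (card W))\<^sup>2 \<le> real (card (f ` W)) * real (card {(u, v) \<in> W \<times> W. f u = f v})"
proof -
  define F where "F = (\<lambda>j. {w \<in> W. f w = j})"
  have fin: "finite (F j)" for j using assms by (simp add: F_def)
  have "card W = card (\<Union>j\<in>f ` W. F j)" by (rule arg_cong[where f = card]) (auto simp: F_def)
  also have "\<dots> = (\<Sum>j\<in>f ` W. card (F j))"
    using assms fin by (intro card_UN_disjoint) (auto simp: F_def)
  finally have W: "real (card W) = (\<Sum>j\<in>f ` W. real (card (F j)))" by simp
  have "card {(u, v) \<in> W \<times> W. f u = f v} = card (\<Union>j\<in>f ` W. F j \<times> F j)"
    by (rule arg_cong[where f = card]) (auto simp: F_def)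
  also have "\<dots> = (\<Sum>j\<in>f ` W. card (F j \<times> F j))"
    using assms fin by (intro card_UN_disjoint) (auto simp: F_def)
  finally have "real (card {(u, v) \<in> W \<times> W. f u = f v}) = (\<Sum>j\<in>f ` W. (real (card (F j)))\<^sup>2)"
    by (simp add: card_cartesian_product power2_eq_square)
  then show ?thesis
    using sum_squared_le_sum_of_squares[of "\<lambda>j. real (card (F j))" "f ` W"] by (simp add: W mult.commute)
qed

text \<open>Only the teeth of level \<open>k\<close> are counted. Two in the same mesh column form a
  close pair, so few close pairs force at least 2^k / k^3 columns, each containing at least (2
  lam)^k boxes.\<close>

lemma N_mesh_comb_lower:
  assumes lam: "1/2 \<le> lam" "lam < 1" and \<delta>: "\<delta> > 0" "\<delta> \<le> (1/2) ^ k"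
    and pairs: "real (card (close_pairs lam k)) < real k ^ 3 * 2 ^ k"
  shows "(4 * lam) ^ k \<le> real k ^ 3 * real (N_mesh \<delta> (comb lam))"
proof -
  define c where "c = (\<lambda>w. \<lfloor>column_pos lam w / \<delta>\<rfloor>)"
  define H where "H = c ` Pow {..<k}"
  have finH: "finite H" by (simp add: H_def)
  have "{(u, v) \<in> Pow {..<k} \<times> Pow {..<k}. c u = c v} \<subseteq> close_pairs lam k"
  proof -
    have "\<bar>column_pos lam u - column_pos lam v\<bar> \<le> (1/2) ^ k" if "c u = c v" for u v
    proof -
      have "\<bar>column_pos lam u / \<delta> - column_pos lam v / \<delta>\<bar> \<le> 1"
        using that unfolding c_def by linarith
      then have "\<bar>column_pos lam u - column_pos lam v\<bar> \<le> \<delta>"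
        using \<delta> by (simp add: field_simps flip: diff_divide_distrib)
      then show ?thesis using \<delta> by linarith
    qed
    then show ?thesis by (auto simp: close_pairs_def)
  qed
  moreover have "finite (close_pairs lam k)"
    by (rule finite_subset[of _ "Pow {..<k} \<times> Pow {..<k}"]) (auto simp: close_pairs_def)
  ultimately have "card {(u, v) \<in> Pow {..<k} \<times> Pow {..<k}. c u = c v} \<le> card (close_pairs lam k)"
    by (intro card_mono)
  then have col: "real (card {(u, v) \<in> Pow {..<k} \<times> Pow {..<k}. c u = c v}) \<le> real k ^ 3 * 2 ^ k"
    using pairs by linarith
  have "2 ^ k * 2 ^ k = (real (card (Pow {..<k})))\<^sup>2" by (simp add: card_Pow power2_eq_square)
  also have "\<dots> \<le> real (card H) * real (card {(u, v) \<in> Pow {..<k} \<times> Pow {..<k}. c u = c v})"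
    unfolding H_def by (rule card_sq_le_image_times_collisions) simp
  also have "\<dots> \<le> real (card H) * (real k ^ 3 * 2 ^ k)" by (intro mult_left_mono col) simp
  finally have H: "2 ^ k \<le> real (card H) * real k ^ 3" by simp
  have "H \<times> {0..\<lfloor>lam ^ k / \<delta>\<rfloor>} = mesh_index \<delta> ` teeth lam k"
    unfolding teeth_def image_UN mesh_index_segment[OF \<delta>(1)] H_def c_def by auto
  also have "\<dots> \<subseteq> mesh_index \<delta> ` comb lam" by (auto simp: comb_def)
  finally have sub: "H \<times> {0..\<lfloor>lam ^ k / \<delta>\<rfloor>} \<subseteq> mesh_index \<delta> ` comb lam" .
  obtain K where "1 / \<delta> < 2 ^ K" using real_arch_pow[of 2 "1 / \<delta>"] by auto
  then have fin: "finite (mesh_index \<delta> ` comb lam)"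
    using N_mesh_comb_upper(1)[OF lam \<delta>(1)] less_imp_le by blast
  have "(2 * lam) ^ k = lam ^ k * 2 ^ k" by (simp add: power_mult_distrib)
  also have "\<dots> \<le> lam ^ k * (1 / \<delta>)"
    using \<delta> lam by (intro mult_left_mono) (auto simp: field_simps power_divide)
  also have "\<dots> \<le> of_int (\<lfloor>lam ^ k / \<delta>\<rfloor> + 1)" by simp
  also have "\<dots> = real (card {0..\<lfloor>lam ^ k / \<delta>\<rfloor>})" using lam \<delta> by simp
  finally have row: "(2 * lam) ^ k \<le> real (card {0..\<lfloor>lam ^ k / \<delta>\<rfloor>})" .
  have "(4 * lam) ^ k = 2 ^ k * (2 * lam) ^ k" by (subst power_mult_distrib[symmetric]) simp
  also have "\<dots> \<le> (real (card H) * real k ^ 3) * real (card {0..\<lfloor>lam ^ k / \<delta>\<rfloor>})"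
    using lam by (intro mult_mono H row) auto
  also have "\<dots> = real k ^ 3 * real (card (H \<times> {0..\<lfloor>lam ^ k / \<delta>\<rfloor>}))"
    by (simp add: card_cartesian_product)
  also have "\<dots> \<le> real k ^ 3 * real (card (mesh_index \<delta> ` comb lam))"
    by (intro mult_left_mono of_nat_mono card_mono fin sub) auto
  finally show ?thesis by (simp add: N_mesh_eq_card_image \<delta>)
qed

text \<open>With k the integer part of log_2 (1/\<delta>), \<delta> lies between 2^-(k+1) and 2^-k,
  so the lower count at \<open>k\<close> and the upper count at \<open>k + 1\<close> enclose the box
  number. Their polynomial factors vanish after division of the logarithm by
  \<open>- ln \<delta>\<close>.\<close>

lemma box_dim_comb:
  assumes lam: "1/2 \<le> lam" "lam < 1"
    and pairs: "\<forall>\<^sub>F k in sequentially. real (card (close_pairs lam k)) < real k ^ 3 * 2 ^ k"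
  shows "has_box_dim (comb lam) (ln (4 * lam) / ln 2)"
proof -
  define c where "c = ln (4 * lam)"
  define L where "L = (\<lambda>\<delta>::real. - ln \<delta> / ln 2)"
  \<comment> \<open>These are the two counting bounds as functions of t = log_2 (1/\<delta>), with
    the integer part k replaced by t - 1 or t as monotonicity requires.\<close>
  define lo where "lo = (\<lambda>t::real. ((t - 1) * c - 3 * ln t) / (t * ln 2))"
  define up where "up = (\<lambda>t::real. (ln (2 * t + 6) + (t + 1) * c) / (t * ln 2))"
  have c: "c > 0" using lam by (simp add: c_def)
  obtain k0 where k0: "\<And>k. k \<ge> k0 \<Longrightarrow> real (card (close_pairs lam k)) < real k ^ 3 * 2 ^ k"
    using pairs by (auto simp: eventually_sequentially)
  have L_top: "filterlim L at_top (at_right 0)" unfolding L_def by real_asymp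
  \<comment> \<open>The summand 1 ensures \<open>k \<ge> 1\<close> besides
    \<open>k \<ge> k0\<close>, and keeps \<open>- ln \<delta>\<close> positive even for
    \<open>k0 = 0\<close>.\<close>
  have ev: "\<forall>\<^sub>F \<delta> in at_right 0. \<delta> > 0 \<and> L \<delta> \<ge> real k0 + 1"
    using L_top[unfolded filterlim_at_top, rule_format, of "real k0 + 1"] eventually_at_right_less[of "0::real"]
    by eventually_elim simp
  have bounds: "lo (L \<delta>) \<le> ln (real (N_mesh \<delta> (comb lam))) / - ln \<delta> \<and>
      ln (real (N_mesh \<delta> (comb lam))) / - ln \<delta> \<le> up (L \<delta>)"
    if \<delta>: "\<delta> > 0" and L: "L \<delta> \<ge> real k0 + 1" for \<delta>
  proof -
    define k where "k = nat \<lfloor>L \<delta>\<rfloor>"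
    define n where "n = real (N_mesh \<delta> (comb lam))"
    have k: "real k \<le> L \<delta>" "L \<delta> < real k + 1" "k \<ge> k0" "k \<ge> 1"
      using L unfolding k_def by linarith+
    have ln\<delta>: "- ln \<delta> = L \<delta> * ln 2" by (simp add: L_def)
    have "ln (2 ^ k) \<le> ln (1 / \<delta>)"
      using k(1) \<delta> mult_right_mono[OF k(1), of "ln 2"] by (simp add: ln_realpow ln_div flip: ln\<delta>)
    then have d1: "\<delta> \<le> (1/2) ^ k" using \<delta> by (simp add: field_simps power_divide)
    have "ln (2 ^ (k + 1)) = real (k + 1) * ln 2" by (rule ln_realpow)
    moreover have "ln (1 / \<delta>) = L \<delta> * ln 2" using \<delta> by (simp add: ln_div ln\<delta>)
    ultimately have "ln (1 / \<delta>) \<le> ln (2 ^ (k + 1))"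
      using k(2) by simp
    then have d2: "1 / \<delta> \<le> 2 ^ (k + 1)" using \<delta> by (subst (asm) ln_le_cancel_iff) auto
    have low: "(4 * lam) ^ k \<le> real k ^ 3 * n"
      unfolding n_def by (rule N_mesh_comb_lower[OF lam \<delta> d1 k0[OF k(3)]])
    have upp: "n \<le> (2 * real (k + 1) + 4) * (4 * lam) ^ (k + 1)"
      unfolding n_def by (rule N_mesh_comb_upper(2)[OF lam \<delta> d2])
    have n: "n > 0"
    proof -
      have "0 < (4 * lam) ^ k" using lam by simp
      then show ?thesis using low by (cases "n = 0") (auto simp: n_def)
    qed
    have "real k * c = ln ((4 * lam) ^ k)" unfolding c_def by (rule ln_realpow[symmetric])
    also have "\<dots> \<le> ln (real k ^ 3 * n)" using low lam n k by (subst ln_le_cancel_iff) auto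
    also have "\<dots> = 3 * ln (real k) + ln n" using k n by (simp add: ln_mult ln_realpow)
    also have "ln (real k) \<le> ln (L \<delta>)" using k by (subst ln_le_cancel_iff) auto
    finally have "real k * c \<le> 3 * ln (L \<delta>) + ln n" by simp
    moreover have "(L \<delta> - 1) * c \<le> real k * c" using k c by (intro mult_right_mono) auto
    ultimately have 1: "(L \<delta> - 1) * c - 3 * ln (L \<delta>) \<le> ln n" by linarith
    have "ln n \<le> ln ((2 * real (k + 1) + 4) * (4 * lam) ^ (k + 1))"
      by (intro ln_mono upp n)
    also have "\<dots> = ln (2 * real (k + 1) + 4) + real (k + 1) * c"
      using lam unfolding c_def ln_realpow[symmetric] by (intro ln_mult_pos) auto
    also have "\<dots> \<le> ln (2 * L \<delta> + 6) + (L \<delta> + 1) * c"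
    proof (rule add_mono)
      show "ln (2 * real (k + 1) + 4) \<le> ln (2 * L \<delta> + 6)" using k by (intro ln_mono) auto
      show "real (k + 1) * c \<le> (L \<delta> + 1) * c" using k c by (intro mult_right_mono) auto
    qed
    finally have 2: "ln n \<le> ln (2 * L \<delta> + 6) + (L \<delta> + 1) * c" .
    have "L \<delta> * ln 2 > 0" using L by simp
    then show ?thesis
      using 1 2 unfolding lo_def up_def ln\<delta> n_def[symmetric] by (intro conjI divide_right_mono) auto
  qed
  have "(lo \<longlongrightarrow> c * inverse (ln 2)) at_top" unfolding lo_def using c by real_asymp
  then have lo_lim: "((\<lambda>\<delta>. lo (L \<delta>)) \<longlongrightarrow> c / ln 2) (at_right 0)"
    unfolding divide_inverse by (rule filterlim_compose[OF _ L_top])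
  have "(up \<longlongrightarrow> c * inverse (ln 2)) at_top" unfolding up_def using c by real_asymp
  then have up_lim: "((\<lambda>\<delta>. up (L \<delta>)) \<longlongrightarrow> c / ln 2) (at_right 0)"
    unfolding divide_inverse by (rule filterlim_compose[OF _ L_top])
  have "((\<lambda>\<delta>. ln (real (N_mesh \<delta> (comb lam))) / - ln \<delta>) \<longlongrightarrow> c / ln 2) (at_right 0)"
    by (rule tendsto_sandwich[OF _ _ lo_lim up_lim]; use ev in eventually_elim; use bounds in blast)
  then have lim: "((\<lambda>\<delta>. ereal (ln (real (N_mesh \<delta> (comb lam))) / - ln \<delta>)) \<longlongrightarrow> ereal (c / ln 2)) (at_right 0)"
    by (rule tendsto_ereal)
  have nt: "at_right (0::real) \<noteq> bot" by (rule trivial_limit_at_right_real)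
  have "bounded (comb lam)"
    by (rule bounded_subset[OF _ comb_subset_unit_square])
      (use lam in \<open>auto simp: unit_square_def bounded_Times\<close>)
  then show ?thesis
    unfolding has_box_dim_def upper_box_dim_def lower_box_dim_def c_def[symmetric]
    using lim_imp_Limsup[OF nt lim] lim_imp_Liminf[OF nt lim] by simp
qed

theorem theorem2p2:
  shows "AE lam in lborel. lam \<in> {1/2 <..< 0.668} \<longrightarrow>
           has_box_dim (F_C lam) (ln (4 * lam) / ln 2)"
  using AE_close_pairs
proof (rule AE_mp, intro AE_I2 impI)
  fix lam :: real
  assume pairs: "lam \<in> {1/2..0.668} \<longrightarrow>
      (\<forall>\<^sub>F k in sequentially. real (card (close_pairs lam k)) < real k ^ 3 * 2 ^ k)"
    and lam: "lam \<in> {1/2 <..< 0.668}"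
  then show "has_box_dim (F_C lam) (ln (4 * lam) / ln 2)"
    using box_dim_comb[of lam] by (simp add: F_C_eq_comb)
qed

end
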